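(* Let $\alpha\in\mathbb{R}$, and consider the boundary value problem for twice differentiable functions $u:\mathbb{R}_{>0}\to\mathbb{C}$ $$ \begin{cases} \mathbf{L}_{\phi_{00}}\mathbf{D}^\times u+\alpha\,\mathbf{L}_{\phi_{00}}u=0\quad\text{on }\mathbb{R}_{>0},\\ \lim_{t\to0^+}u(t)=\lim_{t\to+\infty}u(t)=0. \end{cases} $$ If $\Xi(\alpha)\neq 0$, then the only solution is $u=0$. If $\Xi(\alpha)=0$, then the solution is unique up to multiplicative constants: the solutions are exactly the functions $u=C\,u_\alpha$, where $C\in\mathbb{C}$ is a constant and $$ u_\alpha(t)=t^{-\mathrm{i}\alpha}\int_{0^+}^{t}y^{\mathrm{i}\alpha}\,\varTheta_{00}(\mathrm{i}y^2)\,\frac{\mathrm{d}y}{y},\qquad t>0. $$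
   Context: For $\tau\in\mathbb{C}$ with $\operatorname{Im}\tau>0$, let $\vartheta_{00}(\tau)=\sum_{n\in\mathbb{Z}}\mathrm{e}^{\mathrm{i}\pi n^2\tau}$ and $$\varTheta_{00}(\tau)=(\tau/\mathrm{i})^{1/4}\Big(\tau^2\vartheta_{00}''(\tau)+\tfrac32\tau\vartheta_{00}'(\tau)\Big),$$ with the branch of the power that is positive when $\tau/\mathrm{i}>0$. Then for $t>0$, $$\varTheta_{00}(\mathrm{i}t^2)=\pi t^{9/2}\sum_{n=1}^{\infty}n^2(2\pi n^2-3t^{-2})\,\mathrm{e}^{-\pi n^2t^2},$$ which is real and strictly positive for all $t>0$. Put $\phi_{00}(t)=-\log\varTheta_{00}(\mathrm{i}t^2)$ for $t>0$, which is real-valued. The differential operators are $\mathbf{D}^\times f(t)=\frac{t}{\mathrm{i}}f'(t)$ and, for a $C^1$-smooth function $\varphi$, $\mathbf{L}_\varphi f(t)=\mathbf{D}^\times f(t)+f(t)\,\mathbf{D}^\times\varphi(t)$. With $\zeta$ the Riemann zeta function, $\xi(s)=\frac12 s(s-1)\pi^{-s/2}\Gamma(s/2)\zeta(s)$ (an entire function, removable singularities being filled in), and $\Xi(x)=\xi(\frac12+\mathrm{i}x)$ for $x\in\mathbb{C}$. *)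

theory Defs
  imports "HOL-Complex_Analysis.Complex_Analysis"
begin

definition theta00 :: "complex \<Rightarrow> complex" where
  "theta00 \<tau> = (\<Sum>\<^sub>\<infinity>n::int. exp (\<i> * of_real pi * of_int n ^ 2 * \<tau>))"

definition Theta00 :: "complex \<Rightarrow> complex" where
  "Theta00 \<tau> = (\<tau> / \<i>) powr (1/4) *
     (\<tau>\<^sup>2 * deriv (deriv theta00) \<tau> + 3/2 * \<tau> * deriv theta00 \<tau>)"

(* Complex-valued so that the operators below apply to it directly. The principal logarithm
   agrees with the real one, since Theta00 (i t^2) is real and positive for t > 0. *)
definition phi00 :: "real \<Rightarrow> complex" where
  "phi00 t = - Ln (Theta00 (\<i> * of_real (t\<^sup>2)))"

definition D_times :: "(real \<Rightarrow> complex) \<Rightarrow> real \<Rightarrow> complex" where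
  "D_times f t = of_real t / \<i> * vector_derivative f (at t)"

definition L_op :: "(real \<Rightarrow> complex) \<Rightarrow> (real \<Rightarrow> complex) \<Rightarrow> real \<Rightarrow> complex" where
  "L_op \<phi> f t = D_times f t + f t * D_times \<phi> t"

(* The analytic continuation of the Dirichlet series to the plane without 1; the value 0 at the
   pole only serves to make the function unique. *)
definition riemann_zeta :: "complex \<Rightarrow> complex" where
  "riemann_zeta = (THE f. f holomorphic_on (- {1}) \<and> f 1 = 0 \<and>
     (\<forall>s. Re s > 1 \<longrightarrow> (\<lambda>n. 1 / of_nat (Suc n) powr s) sums f s))"

definition riemann_xi :: "complex \<Rightarrow> complex" where
  "riemann_xi = remove_sings
     (\<lambda>s. 1/2 * s * (s - 1) * of_real pi powr (- s / 2) * Gamma (s / 2) * riemann_zeta s)"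

definition riemann_Xi :: "complex \<Rightarrow> complex" where
  "riemann_Xi x = riemann_xi (1/2 + \<i> * x)"

(* A function on the positive reals is represented by a total function whose values at
   nonpositive arguments are irrelevant. *)
definition bvp_solution :: "real \<Rightarrow> (real \<Rightarrow> complex) \<Rightarrow> bool" where
  "bvp_solution \<alpha> u \<longleftrightarrow>
     (\<forall>t>0. u differentiable (at t)) \<and>
     (\<forall>t>0. (\<lambda>s. vector_derivative u (at s)) differentiable (at t)) \<and>
     (\<forall>t>0. L_op phi00 (D_times u) t + of_real \<alpha> * L_op phi00 u t = 0) \<and>
     (u \<longlongrightarrow> 0) (at_right 0) \<and> (u \<longlongrightarrow> 0) at_top"

definition u_sol :: "real \<Rightarrow> real \<Rightarrow> complex" where
  "u_sol \<alpha> t = of_real t powr (- \<i> * of_real \<alpha>) *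
     Lim (at_right 0) (\<lambda>\<epsilon>. integral {\<epsilon>..t}
       (\<lambda>y. of_real y powr (\<i> * of_real \<alpha>) * Theta00 (\<i> * of_real (y\<^sup>2)) / of_real y))"

end

theory Submission
  imports Defs "HOL-Real_Asymp.Real_Asymp"
begin

text \<open>
  Write \<open>\<Phi>(t) = \<Theta>(i t\<^sup>2)\<close> and \<open>\<phi> = - log \<Phi>\<close>. Then \<open>L v = \<Phi> D (v / \<Phi>)\<close>, so the differential
  equation says exactly that \<open>D u + \<alpha> u\<close> is a constant multiple of \<open>\<Phi>\<close>, that is,
  \<open>(t\<^sup>i\<^sup>\<alpha> u)' = c t\<^sup>i\<^sup>\<alpha> \<Phi>(t) / t\<close>. The boundary condition at \<open>0\<close> fixes the constant of integration,
  so that \<open>u = c t\<^sup>-\<^sup>i\<^sup>\<alpha> \<integral>\<^sub>0\<^sup>t y\<^sup>i\<^sup>\<alpha> \<Phi>(y) dy/y\<close>, and since \<open>\<bar>t\<^sup>i\<^sup>\<alpha>\<bar> = 1\<close> the condition at infinity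
  becomes \<open>c I = 0\<close> with \<open>I\<close> the same integral over the half line (\<open>bvp_solution_imp\<close> and
  \<open>bvp_solution_if\<close>). The theorem follows because \<open>I\<close> is half of \<open>\<Xi>(\<alpha>)\<close>
  (\<open>riemann_Xi_eq_kernel_transform\<close>).

  All integrals are taken in the variable \<open>x = log t\<close>, in which \<open>\<Phi>\<close> becomes Polya's kernel. It is
  positive, even, and decays faster than every \<open>e\<^sup>-\<^sup>N\<^sup>\<bar>\<^sup>x\<^sup>\<bar>\<close>. For \<open>x \<ge> 0\<close> positivity and decay can be read off
  from the series, and evenness transfers them to \<open>x < 0\<close>. Evenness is Jacobi's inversion
  formula for \<open>\<Sum> exp (- \<pi> n\<^sup>2 t)\<close>, which follows by Polya's argument: summing \<open>(2 cos y)\<^sup>2\<^sup>m\<close> over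
  the multiples of \<open>\<pi>/l\<close> gives \<open>l\<close> times a sum of binomial coefficients in steps of \<open>l\<close>. When \<open>m\<close>
  and \<open>l\<close> grow with \<open>m \<sim> c l\<^sup>2\<close>, both sides tend to theta series, with reciprocal arguments.

  Because of the decay, \<open>F(w) = \<integral> e\<^sup>w\<^sup>x \<Phi>(e\<^sup>x) dx\<close> is entire. For \<open>Re s > 1\<close> the series of \<open>\<Phi>\<close> may be
  integrated term by term, each term being a Gamma integral, and
  \<open>F(s - 1/2) = (s - 1)/2 \<Gamma>(s/2 + 1) \<pi>\<^sup>-\<^sup>s\<^sup>/\<^sup>2 \<Sum> n\<^sup>-\<^sup>s\<close>. Solving for the Dirichlet series expresses it by
  functions holomorphic away from \<open>s = 1\<close>. By uniqueness of analytic continuation this expression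
  is the zeta function, and unwinding the definition of \<open>\<xi>\<close> turns it into \<open>\<xi>(s) = 2 F(s - 1/2)\<close>.
\<close>

section \<open>Elementary limits\<close>

lemma one_minus_power_le_exp:
  fixes a :: real
  assumes "a \<le> 1"
  shows "(1 - a) ^ m \<le> exp (- (real m * a))"
proof -
  have "1 - a \<le> exp (- a)" using exp_ge_add_one_self[of "- a"] by simp
  hence "(1 - a) ^ m \<le> exp (- a) ^ m" using assms by (intro power_mono) auto
  thus ?thesis by (simp flip: exp_of_nat_mult)
qed

text \<open>The form of \<open>(1 - A/m)\<^sup>m \<rightarrow> e\<^sup>-\<^sup>A\<close> that covers both powers of cosines and products of binomial ratios:
the inequalities \<open>e\<^sup>-\<^sup>a\<^sup>/\<^sup>(\<^sup>1\<^sup>-\<^sup>a\<^sup>) \<le> 1 - a \<le> e\<^sup>-\<^sup>a\<close> squeeze the power.\<close>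
lemma one_minus_power_tendsto_exp:
  fixes a :: "'a \<Rightarrow> real" and m :: "'a \<Rightarrow> nat"
  assumes a: "(a \<longlongrightarrow> 0) F" and ma: "((\<lambda>x. real (m x) * a x) \<longlongrightarrow> A) F"
    and nonneg: "\<forall>\<^sub>F x in F. 0 \<le> a x"
  shows "((\<lambda>x. (1 - a x) ^ m x) \<longlongrightarrow> exp (- A)) F"
proof (rule tendsto_sandwich)
  have small: "\<forall>\<^sub>F x in F. a x < 1"
    using order_tendstoD(2)[OF a] by simp
  show "\<forall>\<^sub>F x in F. exp (- (real (m x) * a x) / (1 - a x)) \<le> (1 - a x) ^ m x"
    using small nonneg
  proof eventually_elim
    case (elim x)
    have "1 / (1 - a x) = 1 + a x / (1 - a x)" using elim by (simp add: field_simps)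
    also have "\<dots> \<le> exp (a x / (1 - a x))" by (rule exp_ge_add_one_self)
    finally have "exp (- (a x / (1 - a x))) \<le> 1 - a x"
      using elim by (simp add: exp_minus field_simps)
    hence "exp (- (a x / (1 - a x))) ^ m x \<le> (1 - a x) ^ m x"
      by (rule power_mono) simp
    thus ?case by (simp flip: exp_of_nat_mult)
  qed
  show "\<forall>\<^sub>F x in F. (1 - a x) ^ m x \<le> exp (- (real (m x) * a x))"
    using small
  proof eventually_elim
    case (elim x)
    thus ?case by (intro one_minus_power_le_exp) simp
  qed
  have "((\<lambda>x. - (real (m x) * a x) / (1 - a x)) \<longlongrightarrow> - A / (1 - 0)) F"
    by (intro tendsto_intros a ma) auto
  thus "((\<lambda>x. exp (- (real (m x) * a x) / (1 - a x))) \<longlongrightarrow> exp (- A)) F"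
    by (intro tendsto_exp) simp
  show "((\<lambda>x. exp (- (real (m x) * a x))) \<longlongrightarrow> exp (- A)) F"
    by (intro tendsto_intros ma)
qed

section \<open>The finite form of the theta inversion\<close>

text \<open>Expand \<open>(e\<^sup>i\<^sup>x + e\<^sup>-\<^sup>i\<^sup>x)\<^sup>2\<^sup>m\<close> by the binomial theorem and take real parts.\<close>
lemma cos_even_power_expansion:
  "(2 * cos x) ^ (2 * m) = (\<Sum>j\<le>2*m. real (2*m choose j) * cos (2 * x * real_of_int (int j - int m)))"
proof -
  have "complex_of_real ((2 * cos x) ^ (2 * m)) = (cis x + cis (- x)) ^ (2 * m)"
    by (simp add: complex_eq_iff cis.code complex_of_real_def flip: of_real_power)
  also have "\<dots> = (\<Sum>j\<le>2*m. of_nat (2*m choose j) * cis (2 * x * real_of_int (int j - int m)))"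
    unfolding binomial_ring
  proof (rule sum.cong[OF refl])
    fix j assume j: "j \<in> {..2*m}"
    have "cis x ^ j * cis (- x) ^ (2 * m - j) = cis (2 * x * real_of_int (int j - int m))"
      using j by (simp add: Complex.DeMoivre cis_mult of_nat_diff algebra_simps)
    thus "of_nat (2*m choose j) * cis x ^ j * cis (- x) ^ (2 * m - j)
        = of_nat (2*m choose j) * cis (2 * x * real_of_int (int j - int m))"
      by (simp add: mult.assoc)
  qed
  finally have "Re (complex_of_real ((2 * cos x) ^ (2 * m))) = Re \<dots>" by simp
  thus ?thesis by simp
qed

text \<open>Orthogonality of characters: the real part of a geometric sum over the \<open>l\<close>-th roots of unity.\<close>
lemma sum_cos_roots_of_unity:
  assumes l: "l > 0"
  shows "(\<Sum>\<nu><l. cos (2 * (pi * real \<nu> / real l) * real_of_int k)) = (if int l dvd k then real l else 0)"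
proof -
  define z where "z = cis (2 * pi * real_of_int k / real l)"
  have cos_eq: "cos (2 * (pi * real \<nu> / real l) * real_of_int k) = Re (z ^ \<nu>)" for \<nu>
    by (simp add: z_def Complex.DeMoivre mult_ac)
  show ?thesis
  proof (cases "int l dvd k")
    case True
    then obtain q where q: "k = int l * q" by blast
    have "2 * pi * real_of_int k / real l = 2 * pi * real_of_int q" using l by (simp add: q)
    hence "z = 1" by (simp only: z_def cis_multiple_2pi Ints_of_int)
    thus ?thesis unfolding cos_eq using True by simp
  next
    case False
    have "z \<noteq> 1"
    proof
      assume "z = 1"
      hence "cos (2 * pi * real_of_int k / real l) = 1" by (simp add: z_def complex_eq_iff)
      then obtain q :: int where "2 * pi * real_of_int k / real l = real_of_int q * 2 * pi"
        by (auto simp: cos_one_2pi_int)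
      hence "real_of_int k = real_of_int (q * int l)" using l by (simp add: field_simps)
      hence "k = q * int l" by (simp only: of_int_eq_iff)
      thus False using False by simp
    qed
    moreover have "z ^ l = 1"
      using l cis_multiple_2pi[of "real_of_int k"] by (simp add: z_def Complex.DeMoivre)
    ultimately have "(\<Sum>\<nu><l. z ^ \<nu>) = 0" by (simp add: geometric_sum)
    hence "Re (\<Sum>\<nu><l. z ^ \<nu>) = 0" by simp
    thus ?thesis unfolding cos_eq using False by simp
  qed
qed

lemma sum_even_binomial_symmetric:
  fixes h :: "int \<Rightarrow> real"
  assumes even: "\<And>k. h (- k) = h k"
  shows "(\<Sum>j\<le>2*m. real (2*m choose j) * h (int j - int m))
       = real (2*m choose m) * h 0 + 2 * (\<Sum>k=1..m. real (2*m choose (m+k)) * h (int k))"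
proof -
  let ?f = "\<lambda>j. real (2*m choose j) * h (int j - int m)"
  have "{..2*m} = {..<m} \<union> {m} \<union> {m+1..2*m}" by auto
  hence "sum ?f {..2*m} = sum ?f ({..<m} \<union> {m} \<union> {m+1..2*m})" by simp
  also have "\<dots> = sum ?f {..<m} + ?f m + sum ?f {m+1..2*m}"
    by (subst sum.union_disjoint; (subst sum.union_disjoint)?; auto)
  also have "sum ?f {m+1..2*m} = (\<Sum>k=1..m. real (2*m choose (m+k)) * h (int k))"
    by (rule sum.reindex_bij_witness[of _ "\<lambda>k. m + k" "\<lambda>j. j - m"]) auto
  also have "sum ?f {..<m} = (\<Sum>k=1..m. real (2*m choose (m+k)) * h (int k))"
  proof (rule sum.reindex_bij_witness[of _ "\<lambda>k. m - k" "\<lambda>j. m - j"])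
    fix j assume "j \<in> {..<m}"
    hence j: "j < m" by simp
    have "2*m choose (m + (m - j)) = 2*m choose j"
      using binomial_symmetric[of j "2*m"] j by (simp add: mult_2)
    moreover have "h (int (m - j)) = h (int j - int m)"
      using even[of "int j - int m"] j by (simp add: of_nat_diff)
    ultimately show "real (2*m choose (m + (m - j))) * h (int (m - j)) = ?f j" by simp
  qed auto
  finally show ?thesis by simp
qed

lemma sum_multiples_reindex:
  fixes h :: "nat \<Rightarrow> real"
  assumes l: "l > 0" and zero: "\<And>k. k > m \<Longrightarrow> h k = 0"
  shows "(\<Sum>k=1..m. if l dvd k then h k else 0) = (\<Sum>\<nu>=1..m. h (\<nu> * l))"
proof -
  have "(\<Sum>k=1..m. if l dvd k then h k else 0) = sum h {k\<in>{1..m}. l dvd k}"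
    by (simp add: sum.If_cases Int_def)
  also have "\<dots> = (\<Sum>\<nu>\<in>{\<nu>\<in>{1..m}. \<nu> * l \<le> m}. h (\<nu> * l))"
    using l by (intro sum.reindex_bij_witness[of _ "\<lambda>\<nu>. \<nu> * l" "\<lambda>k. k div l"])
      (auto simp: div_greater_zero_iff dvd_imp_le Suc_le_eq intro: order.trans[OF div_le_dividend])
  also have "\<dots> = (\<Sum>\<nu>=1..m. h (\<nu> * l))"
    by (rule sum.mono_neutral_left) (auto intro!: zero)
  finally show ?thesis .
qed

text \<open>The finite analogue of Poisson summation that becomes the inversion formula in the limit. Both sides
evaluate \<open>\<Sum>\<^sub>\<nu> (2 cos (\<pi> \<nu> / l))\<^sup>2\<^sup>m\<close> over \<open>\<nu> < l\<close>: on the right, each power is expanded and only the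
exponents divisible by \<open>l\<close> survive; on the left, \<open>\<nu>\<close> and \<open>l - \<nu>\<close>, whose cosines differ in sign only, are paired. For odd \<open>l\<close> only
\<open>\<nu> = 0\<close> has no partner.\<close>
lemma polya_identity:
  fixes m n :: nat
  defines "l \<equiv> 2 * n + 1"
  shows "4 ^ m * (1 + 2 * (\<Sum>\<nu>=1..n. cos (pi * real \<nu> / real l) ^ (2 * m)))
       = real l * (real (2*m choose m) + 2 * (\<Sum>\<nu>=1..m. real (2*m choose (m + \<nu> * l))))"
proof -
  let ?c = "\<lambda>\<nu>. (2 * cos (pi * real \<nu> / real l)) ^ (2 * m)"
  have l: "l > 0" by (simp add: l_def)
  have "sum ?c {..<l} = (\<Sum>\<nu><l. \<Sum>j\<le>2*m. real (2*m choose j) *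
            cos (2 * (pi * real \<nu> / real l) * real_of_int (int j - int m)))"
    by (simp only: cos_even_power_expansion)
  also have "\<dots> = (\<Sum>j\<le>2*m. real (2*m choose j) * (if int l dvd int j - int m then real l else 0))"
    by (subst sum.swap) (simp only: sum_distrib_left[symmetric] sum_cos_roots_of_unity[OF l])
  also have "\<dots> = real (2*m choose m) * real l + 2 *
       (\<Sum>k=1..m. real (2*m choose (m+k)) * (if int l dvd int k then real l else 0))"
    by (subst sum_even_binomial_symmetric[where h = "\<lambda>k. if int l dvd k then real l else 0"]) simp_all
  also have "(\<Sum>k=1..m. real (2*m choose (m+k)) * (if int l dvd int k then real l else 0))
       = real l * (\<Sum>k=1..m. if l dvd k then real (2*m choose (m+k)) else 0)"
    by (simp add: sum_distrib_left if_distrib mult.commute cong: if_cong)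
  also have "(\<Sum>k=1..m. if l dvd k then real (2*m choose (m+k)) else 0)
      = (\<Sum>\<nu>=1..m. real (2*m choose (m + \<nu> * l)))"
    by (rule sum_multiples_reindex[OF l]) simp
  finally have right: "sum ?c {..<l} =
      real l * (real (2*m choose m) + 2 * (\<Sum>\<nu>=1..m. real (2*m choose (m + \<nu> * l))))"
    by (simp add: algebra_simps)
  have "{..<l} = {0} \<union> {1..n} \<union> {n+1..2*n}" by (auto simp: l_def)
  hence "sum ?c {..<l} = sum ?c ({0} \<union> {1..n} \<union> {n+1..2*n})" by simp
  also have "\<dots> = ?c 0 + sum ?c {1..n} + sum ?c {n+1..2*n}"
    by (subst sum.union_disjoint; (subst sum.union_disjoint)?; auto)
  also have "sum ?c {n+1..2*n} = sum ?c {1..n}"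
  proof (rule sum.reindex_bij_witness[of _ "\<lambda>\<nu>. l - \<nu>" "\<lambda>\<nu>. l - \<nu>"])
    fix \<nu> assume \<nu>: "\<nu> \<in> {n+1..2*n}"
    have "pi * real (l - \<nu>) / real l = pi - pi * real \<nu> / real l"
      using \<nu> l by (simp add: of_nat_diff l_def field_simps)
    thus "?c (l - \<nu>) = ?c \<nu>" by (simp add: power_mult)
  qed (auto simp: l_def)
  finally have "sum ?c {..<l} = 4 ^ m + 2 * sum ?c {1..n}" by (simp add: power_mult)
  also have "sum ?c {1..n} = 4 ^ m * (\<Sum>\<nu>=1..n. cos (pi * real \<nu> / real l) ^ (2 * m))"
    by (simp add: power_mult_distrib power_mult sum_distrib_left)
  finally show ?thesis using right by (simp add: algebra_simps)
qed

section \<open>Asymptotics of binomial coefficients\<close>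

lemma central_binomial_fact: "real (2 * m choose m) = fact (2 * m) / (fact m * fact m)"
  using binomial_fact[of m "2 * m", where 'a=real] by (simp add: mult_2)

text \<open>Wallis's product up to \<open>m\<close> equals \<open>(4\<^sup>m / binom (2m) m)\<^sup>2 / (2m + 1)\<close>.\<close>
lemma wallis_central_binomial:
  "(\<lambda>m. 4 ^ m / (real (2*m choose m) * sqrt (real m))) \<longlonglongrightarrow> sqrt pi"
proof -
  define w where "w m = (\<Prod>k=1..m. (4*real k^2) / (4*real k^2 - 1))" for m :: nat
  have w: "w m = (4 ^ m / real (2*m choose m))\<^sup>2 / (2 * real m + 1)" for m
  proof (induction m)
    case (Suc m)
    have pos: "real (2*m choose m) > 0" by simp
    have f2: "(fact (2 * Suc m) :: real) = (2 * real m + 2) * (2 * real m + 1) * fact (2 * m)"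
      by (simp add: algebra_simps)
    have f1: "(fact (Suc m) :: real) = (real m + 1) * fact m" by simp
    have "(2 * x + 2) * (2 * x + 1) * a / ((x + 1) * b * ((x + 1) * b)) = 2 * (2 * x + 1) / (x + 1) * (a / (b * b))"
      if "x \<ge> 0" "b > 0" for a b x :: real
    proof -
      have "(2 * x + 2) * (2 * x + 1) * a / ((x + 1) * b * ((x + 1) * b))
          = ((x + 1) * (2 * (2 * x + 1) * a)) / ((x + 1) * ((x + 1) * (b * b)))"
        by (simp add: algebra_simps)
      also have "\<dots> = (2 * (2 * x + 1) * a) / ((x + 1) * (b * b))"
        using that by (intro mult_divide_mult_cancel_left) simp
      finally show ?thesis by simp
    qed
    hence c: "real (2 * Suc m choose Suc m) = 2 * (2 * real m + 1) / (real m + 1) * real (2 * m choose m)"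
      unfolding central_binomial_fact f1 f2 by simp
    have "w (Suc m) = w m * ((4 * real (Suc m)^2) / (4*real (Suc m)^2 - 1))"
      by (simp add: w_def)
    also have "4*real (Suc m)^2 - 1 = (2 * real m + 1) * (2 * real m + 3)"
      by (simp add: power2_eq_square algebra_simps)
    also have "w m * ((4 * real (Suc m)^2) / ((2 * real m + 1) * (2 * real m + 3)))
      = (4 ^ Suc m / real (2 * Suc m choose Suc m))\<^sup>2 / (2 * real (Suc m) + 1)"
      unfolding Suc.IH c using pos by (simp add: divide_simps power2_eq_square) (simp add: algebra_simps)
    finally show ?case .
  qed (simp add: w_def)
  have "(\<lambda>m. sqrt (w m * ((2 * real m + 1) / real m))) \<longlonglongrightarrow> sqrt (pi / 2 * 2)"
  proof (intro tendsto_intros)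
    show "w \<longlonglongrightarrow> pi / 2" unfolding w_def by (rule wallis)
    show "(\<lambda>m. (2 * real m + 1) / real m) \<longlonglongrightarrow> 2" by real_asymp
  qed
  moreover have "\<forall>\<^sub>F m in sequentially. sqrt (w m * ((2 * real m + 1) / real m))
       = 4 ^ m / (real (2*m choose m) * sqrt (real m))"
    using eventually_gt_at_top[of 0]
  proof eventually_elim
    case (elim m)
    have "w m * ((2 * real m + 1) / real m) = (4 ^ m / (real (2*m choose m) * sqrt (real m)))\<^sup>2"
      by (simp add: w power_mult_distrib power_divide)
    thus ?case by (simp only: real_sqrt_abs) simp
  qed
  ultimately show ?thesis by (simp add: tendsto_cong)
qed

lemma fact_add_prod: "(fact (m + k) :: real) = fact m * (\<Prod>j=1..k. real (m + j))"
  by (induction k) (simp_all add: algebra_simps)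

lemma central_binomial_ratio:
  assumes "k \<le> m"
  shows "real (2*m choose (m+k)) / real (2*m choose m) = (\<Prod>j=1..k. 1 - real k / real (m + j))"
proof -
  have "(\<Prod>j=1..k. 1 - real k / real (m + j)) = (\<Prod>j=1..k. real (m - k + j) / real (m + j))"
    using assms by (intro prod.cong) (auto simp: field_simps of_nat_diff)
  also have "\<dots> = (\<Prod>j=1..k. real (m - k + j)) / (\<Prod>j=1..k. real (m + j))"
    by (rule prod_dividef)
  also have "(\<Prod>j=1..k. real (m - k + j)) = fact m / fact (m - k)"
    using fact_add_prod[of "m - k" k] assms by (simp add: field_simps)
  also have "(\<Prod>j=1..k. real (m + j)) = fact (m + k) / fact m"
    using fact_add_prod[of m k] by (simp add: field_simps)
  finally have "(\<Prod>j=1..k. 1 - real k / real (m + j))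
      = (fact m * fact m) / (fact (m - k) * fact (m + k))" by simp
  moreover have "real (2*m choose (m+k)) = fact (2*m) / (fact (m + k) * fact (m - k))"
    using binomial_fact[of "m+k" "2*m", where 'a=real] assms by (simp add: mult_2)
  ultimately show ?thesis by (simp add: central_binomial_fact)
qed

text \<open>Each of the \<open>k\<close> factors lies between the first and the last one. When \<open>k\<^sup>2/m\<close> tends to \<open>A\<close>, both bounds tend
to \<open>e\<^sup>-\<^sup>A\<close>, and the upper bound also provides the Gaussian majorant for dominated convergence.\<close>
lemma central_binomial_ratio_bounds:
  assumes "k \<le> m" "m > 0"
  shows "(1 - real k / real m) ^ k \<le> real (2*m choose (m+k)) / real (2*m choose m)"
    and "real (2*m choose (m+k)) / real (2*m choose m) \<le> (1 - real k / real (m + k)) ^ k"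
proof -
  have "(\<Prod>j=1..k. 1 - real k / real m) \<le> (\<Prod>j=1..k. 1 - real k / real (m + j))"
    using assms by (intro prod_mono) (auto intro!: divide_left_mono)
  thus "(1 - real k / real m) ^ k \<le> real (2*m choose (m+k)) / real (2*m choose m)"
    using assms by (simp add: central_binomial_ratio)
  have "(\<Prod>j=1..k. 1 - real k / real (m + j)) \<le> (\<Prod>j=1..k. 1 - real k / real (m + k))"
    using assms by (intro prod_mono) (auto intro!: divide_left_mono simp: field_simps)
  thus "real (2*m choose (m+k)) / real (2*m choose m) \<le> (1 - real k / real (m + k)) ^ k"
    using assms by (simp add: central_binomial_ratio)
qed

section \<open>Jacobi inversion of the theta series\<close>

lemma summable_exp_square:
  fixes b :: real
  assumes "b > 0"
  shows "summable (\<lambda>\<nu>. exp (- b * real (Suc \<nu>) ^ 2))"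
proof (rule summable_comparison_test)
  show "\<exists>N. \<forall>\<nu>\<ge>N. norm (exp (- b * real (Suc \<nu>) ^ 2)) \<le> exp (- b) ^ \<nu>"
  proof (intro exI allI impI)
    fix \<nu> :: nat
    have "real \<nu> \<le> real (Suc \<nu>) ^ 2" by (simp add: power2_eq_square algebra_simps)
    thus "norm (exp (- b * real (Suc \<nu>) ^ 2)) \<le> exp (- b) ^ \<nu>"
      using assms by (simp flip: exp_of_nat_mult add: mult.commute)
  qed
  show "summable (\<lambda>\<nu>. exp (- b) ^ \<nu>)" using assms by (intro summable_geometric) simp
qed

text \<open>Tannery's theorem with a majorant valid for all indices at once.\<close>
lemma tannery_uniform:
  fixes a :: "nat \<Rightarrow> nat \<Rightarrow> real"
  assumes lim: "\<And>\<nu>. (\<lambda>n. a \<nu> n) \<longlonglongrightarrow> b \<nu>" and M: "summable M"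
    and bound: "\<forall>\<^sub>F n in sequentially. \<forall>\<nu>. \<bar>a \<nu> n\<bar> \<le> M \<nu>"
  shows "(\<lambda>n. \<Sum>\<nu>. a \<nu> n) \<longlonglongrightarrow> (\<Sum>\<nu>. b \<nu>)"
proof -
  have "\<forall>\<^sub>F (\<nu>, n) in at_top \<times>\<^sub>F sequentially. norm (a \<nu> n) \<le> M \<nu>"
    unfolding eventually_prod_filter using bound
    by (intro exI[of _ "\<lambda>_. True"] exI[of _ "\<lambda>n. \<forall>\<nu>. \<bar>a \<nu> n\<bar> \<le> M \<nu>"]) auto
  from tannerys_theorem[OF lim this M] show ?thesis by simp
qed


text \<open>From \<open>\<bar>x\<bar> \<le> \<bar>tan x\<bar>\<close> comes \<open>cos\<^sup>2 x \<le> 1 / (1 + x\<^sup>2)\<close>, and this is at most \<open>1 - x\<^sup>2/4\<close> as long as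
\<open>x\<^sup>2 \<le> 3\<close>. The bound is the Gaussian majorant for the cosine side of Polya's identity.\<close>
lemma cos_even_power_le_exp:
  assumes "\<bar>x\<bar> < pi / 2"
  shows "cos x ^ (2 * m) \<le> exp (- (real m * x\<^sup>2 / 4))"
proof -
  have cos0: "cos x > 0" using assms by (intro cos_gt_zero_pi) auto
  have "x\<^sup>2 \<le> (tan x)\<^sup>2" using abs_tan_ge[of x] assms by (simp add: abs_le_square_iff)
  hence "1 + x\<^sup>2 \<le> 1 / (cos x)\<^sup>2"
    using tan_sec[of x] cos0 by (simp add: inverse_eq_divide power_one_over)
  hence "(cos x)\<^sup>2 \<le> 1 / (1 + x\<^sup>2)"
    using cos0 by (simp add: field_simps add_pos_nonneg)
  also have x2: "x\<^sup>2 \<le> 3"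
  proof -
    have "\<bar>x\<bar> \<le> 1.7" using assms pi_approx(2) by simp
    hence "x\<^sup>2 \<le> 1.7\<^sup>2" by (metis abs_ge_zero power2_abs power_mono)
    thus ?thesis by (simp add: power2_eq_square)
  qed
  have "1 / (1 + x\<^sup>2) \<le> 1 - x\<^sup>2 / 4"
  proof -
    have "(1 - x\<^sup>2 / 4) * (1 + x\<^sup>2) - 1 = x\<^sup>2 * (3 - x\<^sup>2) / 4"
      by (simp add: field_simps)
    also have "\<dots> \<ge> 0" using x2 by simp
    finally show ?thesis by (simp add: divide_le_eq add_pos_nonneg)
  qed
  finally have "((cos x)\<^sup>2) ^ m \<le> (1 - x\<^sup>2 / 4) ^ m" by (rule power_mono) simp
  also have "\<dots> \<le> exp (- (real m * (x\<^sup>2 / 4)))"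
    using x2 by (intro one_minus_power_le_exp) simp
  finally show ?thesis by (simp add: power_mult)
qed

text \<open>Polya's identity is divided by \<open>l\<close> times the central binomial coefficient and its limit is taken along \<open>l = 2n + 1\<close>
and \<open>m \<sim> c l\<^sup>2\<close>. The cosine terms tend to \<open>exp (- \<pi>\<^sup>2 \<nu>\<^sup>2 c)\<close> and the binomial ratios to
\<open>exp (- \<nu>\<^sup>2 / c)\<close>, so \<open>c = t / \<pi>\<close> produces the two theta series. Wallis's formula evaluates the
prefactor as \<open>sqrt (\<pi> c) = sqrt t\<close>.\<close>
theorem jacobi_theta_inversion:
  fixes t :: real
  assumes t: "t > 0"
  shows "1 + 2 * (\<Sum>\<nu>. exp (- (pi * real (Suc \<nu>) ^ 2 / t)))
       = sqrt t * (1 + 2 * (\<Sum>\<nu>. exp (- (pi * real (Suc \<nu>) ^ 2 * t))))"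
proof -
  define c where "c = t / pi"
  have c: "c > 0" using t by (simp add: c_def)
  define l where "l n = 2 * n + 1" for n :: nat
  define m where "m n = nat \<lceil>c * real (l n) ^ 2\<rceil>" for n
  have l: "real (l n) > 0" for n by (simp add: l_def)
  have m_ge: "real (m n) \<ge> c * real (l n) ^ 2" for n
    unfolding m_def by linarith
  have m_le: "real (m n) \<le> c * real (l n) ^ 2 + 1" for n
  proof -
    have "0 \<le> c * real (l n) ^ 2" using c by simp
    thus ?thesis unfolding m_def by linarith
  qed
  have m: "real (m n) > 0" for n
    using m_ge[of n] c l[of n] by (smt (verit) mult_pos_pos zero_less_power)
  have m_pos: "m n > 0" for n using m[of n] by simp
  have q_ge: "c \<le> real (m n) / real (l n) ^ 2" for n
    using m_ge[of n] l[of n] by (simp add: field_simps)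
  have q_le: "real (m n) / real (l n) ^ 2 \<le> c + 1 / real (l n) ^ 2" for n
    using m_le[of n] l[of n] by (simp add: field_simps)
  have q_lim: "(\<lambda>n. real (m n) / real (l n) ^ 2) \<longlonglongrightarrow> c"
  proof (rule tendsto_sandwich[of "\<lambda>_. c" _ _ "\<lambda>n. c + 1 / real (l n) ^ 2"])
    show "(\<lambda>n. c + 1 / real (l n) ^ 2) \<longlonglongrightarrow> c" unfolding l_def by real_asymp
  qed (use q_ge q_le in auto)
  have inv_l: "(\<lambda>n. real \<nu> / real (l n)) \<longlonglongrightarrow> 0" for \<nu> unfolding l_def by real_asymp
  have m_top: "filterlim m at_top sequentially"
  proof -
    have "filterlim (\<lambda>n. c * real (l n) ^ 2) at_top sequentially"
      unfolding l_def using c by real_asymp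
    hence "filterlim (\<lambda>n. real (m n)) at_top sequentially"
      by (rule filterlim_at_top_mono) (use m_ge in auto)
    thus ?thesis by (simp add: filterlim_sequentially_iff_filterlim_real)
  qed

  \<comment> \<open>The two sides of Polya's identity as series in \<open>\<nu>\<close>. The cosine sum must be cut off at \<open>n\<close>, whereas the binomial coefficients vanish by themselves for large \<open>\<nu>\<close>.\<close>
  define A where "A \<nu> n = (if Suc \<nu> \<le> n then cos (pi * real (Suc \<nu>) / real (l n)) ^ (2 * m n) else 0)" for \<nu> n
  define B where "B \<nu> n = real (2 * m n choose (m n + Suc \<nu> * l n)) / real (2 * m n choose m n)" for \<nu> n

  have A_lim: "(\<lambda>n. \<Sum>\<nu>. A \<nu> n) \<longlonglongrightarrow> (\<Sum>\<nu>. exp (- (pi * real (Suc \<nu>) ^ 2 * t)))"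
  proof (rule tannery_uniform)
    fix \<nu> :: nat
    let ?x = "\<lambda>n. pi * real (Suc \<nu>) / real (l n)"
    have "(\<lambda>n. (1 - (sin (?x n))\<^sup>2) ^ m n) \<longlonglongrightarrow> exp (- (c * (pi * real (Suc \<nu>))\<^sup>2))"
    proof (rule one_minus_power_tendsto_exp)
      have "?x \<longlonglongrightarrow> 0"
        using tendsto_mult_left[OF inv_l[of "Suc \<nu>"], of pi] by simp
      hence "(\<lambda>n. (sin (?x n))\<^sup>2) \<longlonglongrightarrow> (sin 0)\<^sup>2" by (intro tendsto_intros)
      thus "(\<lambda>n. (sin (?x n))\<^sup>2) \<longlonglongrightarrow> 0" by simp
      have "(\<lambda>n. real (l n) * sin (p / real (l n))) \<longlonglongrightarrow> p" if "p > 0" for p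
        unfolding l_def using that by real_asymp
      hence "(\<lambda>n. real (m n) / real (l n) ^ 2 * (real (l n) * sin (?x n))\<^sup>2) \<longlonglongrightarrow> c * (pi * real (Suc \<nu>))\<^sup>2"
        by (intro tendsto_mult[OF q_lim tendsto_power]) simp
      also have "(\<lambda>n. real (m n) / real (l n) ^ 2 * (real (l n) * sin (?x n))\<^sup>2) = (\<lambda>n. real (m n) * (sin (?x n))\<^sup>2)"
        using l by (simp add: power_mult_distrib field_simps fun_eq_iff)
      finally show "(\<lambda>n. real (m n) * (sin (?x n))\<^sup>2) \<longlonglongrightarrow> c * (pi * real (Suc \<nu>))\<^sup>2" .
    qed simp
    moreover have "\<forall>\<^sub>F n in sequentially. (1 - (sin (?x n))\<^sup>2) ^ m n = A \<nu> n"
      using eventually_ge_at_top[of "Suc \<nu>"]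
      by eventually_elim (simp add: A_def power_mult cos_squared_eq)
    moreover have "c * (pi * real (Suc \<nu>))\<^sup>2 = pi * real (Suc \<nu>) ^ 2 * t"
      by (simp add: c_def power2_eq_square)
    ultimately show "(\<lambda>n. A \<nu> n) \<longlonglongrightarrow> exp (- (pi * real (Suc \<nu>) ^ 2 * t))"
      by (simp add: tendsto_cong)
  next
    show "summable (\<lambda>\<nu>. exp (- (c * pi\<^sup>2 / 4) * real (Suc \<nu>) ^ 2))"
      using c by (intro summable_exp_square) simp
    have "\<bar>A \<nu> n\<bar> \<le> exp (- (c * pi\<^sup>2 / 4) * real (Suc \<nu>) ^ 2)" for \<nu> n
    proof (cases "Suc \<nu> \<le> n")
      case True
      let ?x = "pi * real (Suc \<nu>) / real (l n)"
      have "2 * real (Suc \<nu>) < real (l n)" using True by (simp add: l_def)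
      hence "pi * (2 * real (Suc \<nu>)) < pi * real (l n)" by (intro mult_strict_left_mono) auto
      hence "?x < pi / 2" using l[of n] by (simp add: field_simps)
      moreover have "?x \<ge> 0" using l[of n] by simp
      ultimately have "A \<nu> n \<le> exp (- (real (m n) * ?x\<^sup>2 / 4))"
        using True cos_even_power_le_exp[of ?x "m n"] by (simp add: A_def)
      also have "real (m n) * ?x\<^sup>2 / 4 = real (m n) / real (l n) ^ 2 * (pi\<^sup>2 / 4 * real (Suc \<nu>) ^ 2)"
        by (simp add: power_mult_distrib power_divide)
      also have "exp (- \<dots>) \<le> exp (- (c * (pi\<^sup>2 / 4 * real (Suc \<nu>) ^ 2)))"
        using q_ge[of n] by (simp only: exp_le_cancel_iff neg_le_iff_le) (intro mult_right_mono, auto)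
      finally show ?thesis using True by (simp add: A_def power_mult algebra_simps)
    qed (simp add: A_def)
    thus "\<forall>\<^sub>F n in sequentially. \<forall>\<nu>. \<bar>A \<nu> n\<bar> \<le> exp (- (c * pi\<^sup>2 / 4) * real (Suc \<nu>) ^ 2)" by simp
  qed

  have B_lim: "(\<lambda>n. \<Sum>\<nu>. B \<nu> n) \<longlonglongrightarrow> (\<Sum>\<nu>. exp (- (pi * real (Suc \<nu>) ^ 2 / t)))"
  proof (rule tannery_uniform)
    fix \<nu> :: nat
    let ?k = "\<lambda>n. Suc \<nu> * l n"
    let ?q = "\<lambda>n. real (m n) / real (l n) ^ 2" and ?r = "\<lambda>n. real (Suc \<nu>) / real (l n)"
    have lo: "?r n / ?q n = real (?k n) / real (m n)" for n
      using l[of n] m[of n] by (simp add: power2_eq_square field_simps)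
    have up: "?r n / (?q n + ?r n) = real (?k n) / real (m n + ?k n)" for n
    proof -
      have r: "?r n = real (?k n) / real (l n) ^ 2"
        using l[of n] by (simp add: power2_eq_square field_simps)
      have "?q n + ?r n = real (m n + ?k n) / real (l n) ^ 2"
        unfolding r by (simp add: add_divide_distrib)
      thus ?thesis unfolding r using l[of n] by simp
    qed
    have sq: "real (?k n) * ?r n = real (Suc \<nu>) ^ 2" for n
      using l[of n] by (simp only: of_nat_mult) (simp add: power2_eq_square)
    have lo2: "real (Suc \<nu>) ^ 2 / ?q n = real (?k n) * (real (?k n) / real (m n))" for n
      by (simp only: lo[of n, symmetric] sq[of n, symmetric] times_divide_eq_right)
    have up2: "real (Suc \<nu>) ^ 2 / (?q n + ?r n) = real (?k n) * (real (?k n) / real (m n + ?k n))" for n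
      by (simp only: up[of n, symmetric] sq[of n, symmetric] times_divide_eq_right)
    have "(\<lambda>n. ?r n / ?q n) \<longlonglongrightarrow> 0 / c" using c by (intro tendsto_intros inv_l q_lim) auto
    hence lim_lo: "(\<lambda>n. real (?k n) / real (m n)) \<longlonglongrightarrow> 0" unfolding lo by simp
    have "(\<lambda>n. ?r n / (?q n + ?r n)) \<longlonglongrightarrow> 0 / (c + 0)" using c by (intro tendsto_intros inv_l q_lim) auto
    hence lim_up: "(\<lambda>n. real (?k n) / real (m n + ?k n)) \<longlonglongrightarrow> 0" unfolding up by simp
    have "(\<lambda>n. real (Suc \<nu>) ^ 2 / ?q n) \<longlonglongrightarrow> real (Suc \<nu>) ^ 2 / c"
      using c by (intro tendsto_intros q_lim) auto
    also have "(\<lambda>n. real (Suc \<nu>) ^ 2 / ?q n) = (\<lambda>n. real (?k n) * (real (?k n) / real (m n)))"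
      by (simp only: lo2)
    finally have lim_lo2: "(\<lambda>n. real (?k n) * (real (?k n) / real (m n))) \<longlonglongrightarrow> real (Suc \<nu>) ^ 2 / c" .
    have "(\<lambda>n. real (Suc \<nu>) ^ 2 / (?q n + ?r n)) \<longlonglongrightarrow> real (Suc \<nu>) ^ 2 / (c + 0)"
      using c by (intro tendsto_intros q_lim inv_l) auto
    also have "(\<lambda>n. real (Suc \<nu>) ^ 2 / (?q n + ?r n)) = (\<lambda>n. real (?k n) * (real (?k n) / real (m n + ?k n)))"
      by (simp only: up2)
    finally have lim_up2: "(\<lambda>n. real (?k n) * (real (?k n) / real (m n + ?k n))) \<longlonglongrightarrow> real (Suc \<nu>) ^ 2 / c" by simp
    have k_le: "\<forall>\<^sub>F n in sequentially. ?k n \<le> m n"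
    proof (rule eventually_mono[OF order_tendstoD(2)[OF lim_lo]])
      show "(0 :: real) < 1" by simp
      fix n assume "real (?k n) / real (m n) < 1"
      hence "real (?k n) < real (m n)" using m[of n] by (simp add: field_simps)
      thus "?k n \<le> m n" by linarith
    qed
    have "(\<lambda>n. B \<nu> n) \<longlonglongrightarrow> exp (- (real (Suc \<nu>) ^ 2 / c))"
    proof (rule tendsto_sandwich)
      show "\<forall>\<^sub>F n in sequentially. (1 - real (?k n) / real (m n)) ^ ?k n \<le> B \<nu> n"
        using k_le by eventually_elim (unfold B_def, rule central_binomial_ratio_bounds(1)[OF _ m_pos])
      show "\<forall>\<^sub>F n in sequentially. B \<nu> n \<le> (1 - real (?k n) / real (m n + ?k n)) ^ ?k n"
        using k_le by eventually_elim (unfold B_def, rule central_binomial_ratio_bounds(2)[OF _ m_pos])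
      show "(\<lambda>n. (1 - real (?k n) / real (m n)) ^ ?k n) \<longlonglongrightarrow> exp (- (real (Suc \<nu>) ^ 2 / c))"
        by (rule one_minus_power_tendsto_exp[OF lim_lo lim_lo2]) simp
      show "(\<lambda>n. (1 - real (?k n) / real (m n + ?k n)) ^ ?k n) \<longlonglongrightarrow> exp (- (real (Suc \<nu>) ^ 2 / c))"
        by (rule one_minus_power_tendsto_exp[OF lim_up lim_up2]) simp
    qed
    thus "(\<lambda>n. B \<nu> n) \<longlonglongrightarrow> exp (- (pi * real (Suc \<nu>) ^ 2 / t))"
      by (simp add: c_def mult.commute)
  next
    show "summable (\<lambda>\<nu>. exp (- (1 / (2 * (c + 1))) * real (Suc \<nu>) ^ 2))"
      using c by (intro summable_exp_square) simp
    have "\<bar>B \<nu> n\<bar> \<le> exp (- (1 / (2 * (c + 1))) * real (Suc \<nu>) ^ 2)" for \<nu> n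
    proof (cases "Suc \<nu> * l n \<le> m n")
      case True
      let ?k = "Suc \<nu> * l n"
      have "real (l n) ^ 2 \<ge> 1" by (simp add: l_def)
      hence "c + 1 / real (l n) ^ 2 \<le> c + 1" by (simp add: divide_le_eq)
      with q_le[of n] have "real (m n) / real (l n) ^ 2 \<le> c + 1" by linarith
      hence m_le': "real (m n) \<le> (c + 1) * real (l n) ^ 2" using l[of n] by (simp add: field_simps)
      have "B \<nu> n \<le> (1 - real ?k / real (m n + ?k)) ^ ?k"
        unfolding B_def using True m[of n] by (intro central_binomial_ratio_bounds) auto
      also have "\<dots> \<le> exp (- (real ?k * (real ?k / real (m n + ?k))))"
        using m[of n] by (intro one_minus_power_le_exp) (simp del: of_nat_mult of_nat_Suc mult_Suc)
      also have "\<dots> \<le> exp (- (1 / (2 * (c + 1)) * real (Suc \<nu>) ^ 2))"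
      proof -
        have "real (m n + ?k) \<le> 2 * ((c + 1) * real (l n) ^ 2)"
          using m_le' True by linarith
        moreover have "0 < 2 * ((c + 1) * real (l n) ^ 2)" using c l[of n] by simp
        moreover have "0 < real (m n + ?k)" using m[of n] by (simp del: of_nat_mult of_nat_Suc mult_Suc)
        ultimately have "real ?k ^ 2 / (2 * ((c + 1) * real (l n) ^ 2)) \<le> real ?k ^ 2 / real (m n + ?k)"
          by (intro divide_left_mono mult_pos_pos[of "2 * ((c + 1) * real (l n) ^ 2)"]) simp_all
        also have "real ?k ^ 2 / (2 * ((c + 1) * real (l n) ^ 2)) = 1 / (2 * (c + 1)) * real (Suc \<nu>) ^ 2"
          unfolding of_nat_mult power_mult_distrib using l[of n] c by simp
        finally show ?thesis by (simp add: power2_eq_square)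
      qed
      finally show ?thesis by (simp add: B_def)
    next
      case False
      hence zero: "2 * m n choose (m n + Suc \<nu> * l n) = 0" by (intro binomial_eq_0) simp
      show ?thesis by (simp only: B_def zero of_nat_0 div_0 abs_zero exp_ge_zero)
    qed
    thus "\<forall>\<^sub>F n in sequentially. \<forall>\<nu>. \<bar>B \<nu> n\<bar> \<le> exp (- (1 / (2 * (c + 1))) * real (Suc \<nu>) ^ 2)" by simp
  qed

  have identity: "4 ^ m n / (real (2 * m n choose m n) * sqrt (real (m n))) * sqrt (real (m n) / real (l n) ^ 2)
      * (1 + 2 * (\<Sum>\<nu>. A \<nu> n)) = 1 + 2 * (\<Sum>\<nu>. B \<nu> n)" for n
  proof -
    have pos: "real (2 * m n choose m n) > 0" by simp
    have shift: "(\<Sum>\<nu>. f (Suc \<nu>)) = (\<Sum>\<nu>=1..N. f \<nu>)" if "\<And>\<nu>. \<nu> > N \<Longrightarrow> f \<nu> = 0" for f :: "nat \<Rightarrow> real" and N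
    proof -
      have "(\<Sum>\<nu>. f (Suc \<nu>)) = (\<Sum>\<nu><N. f (Suc \<nu>))" using that by (intro suminf_finite) auto
      also have "\<dots> = (\<Sum>\<nu>=1..N. f \<nu>)"
        by (rule sum.reindex_bij_witness[of _ "\<lambda>i. i - 1" Suc]) auto
      finally show ?thesis .
    qed
    have A_sum: "(\<Sum>\<nu>. A \<nu> n) = (\<Sum>\<nu>=1..n. cos (pi * real \<nu> / real (l n)) ^ (2 * m n))"
      unfolding A_def by (subst shift[where N = n]) auto
    have B_sum: "(\<Sum>\<nu>. B \<nu> n) = (\<Sum>\<nu>=1..m n. real (2 * m n choose (m n + \<nu> * l n))) / real (2 * m n choose m n)"
      unfolding B_def sum_divide_distrib
      by (subst shift[where N = "m n"]) (auto simp: l_def)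
    have "sqrt (real (m n) / real (l n) ^ 2) = sqrt (real (m n)) / real (l n)"
      using l[of n] by (simp add: real_sqrt_divide)
    moreover have "4 ^ m n * (1 + 2 * (\<Sum>\<nu>. A \<nu> n)) = real (l n) * (real (2 * m n choose m n) * (1 + 2 * (\<Sum>\<nu>. B \<nu> n)))"
      using polya_identity[of "m n" n] pos unfolding A_sum B_sum l_def by (simp add: field_simps)
    moreover have "4 ^ m n / (real (2 * m n choose m n) * sqrt (real (m n))) * (sqrt (real (m n)) / real (l n)) * S
        = (4 ^ m n * S) / (real (l n) * real (2 * m n choose m n))" for S
      using m[of n] by simp
    ultimately show ?thesis using l[of n] pos by simp
  qed
  have "(\<lambda>n. 4 ^ m n / (real (2 * m n choose m n) * sqrt (real (m n))) * sqrt (real (m n) / real (l n) ^ 2)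
      * (1 + 2 * (\<Sum>\<nu>. A \<nu> n))) \<longlonglongrightarrow> sqrt pi * sqrt c * (1 + 2 * (\<Sum>\<nu>. exp (- (pi * real (Suc \<nu>) ^ 2 * t))))"
    by (intro tendsto_intros A_lim q_lim filterlim_compose[OF wallis_central_binomial m_top])
  moreover have "(\<lambda>n. 1 + 2 * (\<Sum>\<nu>. B \<nu> n)) \<longlonglongrightarrow> 1 + 2 * (\<Sum>\<nu>. exp (- (pi * real (Suc \<nu>) ^ 2 / t)))"
    by (intro tendsto_intros B_lim)
  ultimately have "1 + 2 * (\<Sum>\<nu>. exp (- (pi * real (Suc \<nu>) ^ 2 / t)))
      = sqrt pi * sqrt c * (1 + 2 * (\<Sum>\<nu>. exp (- (pi * real (Suc \<nu>) ^ 2 * t))))"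
    unfolding identity by (rule LIMSEQ_unique[rotated])
  moreover have "sqrt pi * sqrt c = sqrt t" by (simp add: c_def flip: real_sqrt_mult)
  ultimately show ?thesis by simp
qed

section \<open>Moments of the theta series\<close>

lemma power_div_fact_le_exp:
  fixes y :: real
  assumes "y \<ge> 0"
  shows "y ^ k / fact k \<le> exp y"
proof -
  have "(\<Sum>i\<in>{k}. y ^ i / fact i) \<le> (\<Sum>i. y ^ i / fact i)"
    using assms summable_exp[of y] by (intro sum_le_suminf) (auto simp: field_simps)
  thus ?thesis by (simp add: exp_def divide_inverse mult.commute)
qed

lemma summable_moment_exp_square:
  fixes b :: real
  assumes b: "b > 0"
  shows "summable (\<lambda>n. real (Suc n) ^ (2 * j) * exp (- (b * real (Suc n) ^ 2)))"
proof (rule summable_comparison_test)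
  let ?C = "fact j / (b / 2) ^ j"
  show "\<exists>N. \<forall>n\<ge>N. norm (real (Suc n) ^ (2 * j) * exp (- (b * real (Suc n) ^ 2)))
      \<le> ?C * exp (- (b / 2) * real (Suc n) ^ 2)"
  proof (intro exI allI impI)
    fix n :: nat
    define y where "y = b / 2 * real (Suc n) ^ 2"
    have "y ^ j / fact j \<le> exp y" using b by (intro power_div_fact_le_exp) (simp add: y_def)
    hence "real (Suc n) ^ (2 * j) \<le> ?C * exp y"
      using b unfolding y_def power_mult_distrib power_mult by (simp add: field_simps)
    hence "real (Suc n) ^ (2 * j) * exp (- (2 * y)) \<le> (?C * exp y) * exp (- (2 * y))"
      by (intro mult_right_mono) auto
    also have "\<dots> = ?C * exp (- y)" by (simp add: mult.assoc flip: exp_add)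
    finally show "norm (real (Suc n) ^ (2 * j) * exp (- (b * real (Suc n) ^ 2)))
      \<le> ?C * exp (- (b / 2) * real (Suc n) ^ 2)" by (simp add: y_def)
  qed
  show "summable (\<lambda>n. ?C * exp (- (b / 2) * real (Suc n) ^ 2))"
    using b by (intro summable_mult summable_exp_square) simp
qed

text \<open>Differentiating \<open>\<Sum> exp (- \<pi> n\<^sup>2 z)\<close> brings down factors \<open>- \<pi> n\<^sup>2\<close>. These moments, on the half plane
\<open>Re z > 0\<close> with \<open>\<tau> = i z\<close>, therefore express \<open>theta00\<close> and all its derivatives.\<close>
definition theta_moment :: "nat \<Rightarrow> complex \<Rightarrow> complex" where
  "theta_moment j z = (\<Sum>n. of_nat (Suc n) ^ (2 * j) * exp (- (of_real pi * of_nat (Suc n) ^ 2 * z)))"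

lemma norm_theta_moment_term:
  "norm (of_nat (Suc n) ^ (2 * j) * exp (- (of_real pi * of_nat (Suc n) ^ 2 * z)))
     = real (Suc n) ^ (2 * j) * exp (- (pi * Re z * real (Suc n) ^ 2))"
proof -
  have "of_real pi * of_nat (Suc n) ^ 2 * z = of_real (pi * real (Suc n) ^ 2) * z"
    by (simp del: of_nat_Suc)
  hence "Re (of_real pi * of_nat (Suc n) ^ 2 * z) = pi * Re z * real (Suc n) ^ 2"
    by (simp del: of_real_mult of_real_power)
  thus ?thesis by (simp add: norm_mult norm_power del: of_nat_Suc)
qed

lemma summable_norm_theta_moment:
  assumes "Re z > 0"
  shows "summable (\<lambda>n. norm (of_nat (Suc n) ^ (2 * j) * exp (- (of_real pi * of_nat (Suc n) ^ 2 * z))))"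
  unfolding norm_theta_moment_term using assms by (intro summable_moment_exp_square) simp

lemma theta_moment_sums:
  assumes "Re z > 0"
  shows "(\<lambda>n. of_nat (Suc n) ^ (2 * j) * exp (- (of_real pi * of_nat (Suc n) ^ 2 * z))) sums theta_moment j z"
  unfolding theta_moment_def
  by (intro summable_sums summable_norm_cancel[OF summable_norm_theta_moment[OF assms]])

lemma open_Re_pos: "open {z. Re z > 0}"
  by (intro open_halfspace_Re_gt)

text \<open>On the disc of radius \<open>Re z / 2\<close> about \<open>z\<close> the terms are dominated by their values at \<open>Re z / 2\<close>, so the series
may be differentiated term by term.\<close>
lemma has_field_derivative_theta_moment:
  assumes z: "Re z > 0"
  shows "(theta_moment j has_field_derivative - of_real pi * theta_moment (Suc j) z) (at z)"
proof -
  let ?f = "\<lambda>j n z :: complex. of_nat (Suc n) ^ (2 * j) * exp (- (of_real pi * of_nat (Suc n) ^ 2 * z))"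
  let ?S = "{z. Re z > 0}"
  have "\<exists>g g'. \<forall>x \<in> ?S. ((\<lambda>n. ?f j n x) sums g x) \<and> ((\<lambda>n. - of_real pi * ?f (Suc j) n x) sums g' x)
      \<and> (g has_field_derivative g' x) (at x)"
  proof (rule series_and_derivative_comparison_complex[OF open_Re_pos])
    show "(?f j n has_field_derivative - of_real pi * ?f (Suc j) n x) (at x)" for n x
      by (auto intro!: derivative_eq_intros simp: power_mult power2_eq_square simp del: of_nat_Suc)
  next
    fix x assume "x \<in> ?S"
    hence x: "Re x > 0" by simp
    let ?h = "\<lambda>n. complex_of_real (real (Suc n) ^ (2 * j) * exp (- (pi * (Re x / 2) * real (Suc n) ^ 2)))"
    have "summable ?h"
      using x unfolding summable_complex_of_real by (intro summable_moment_exp_square) simp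
    moreover have "range ?h \<subseteq> \<real>\<^sub>\<ge>\<^sub>0" by (auto simp del: of_nat_Suc)
    moreover have "norm (?f j n y) \<le> norm (?h n)" if "y \<in> ball x (Re x / 2) \<inter> ?S" for n y
    proof -
      have "\<bar>Re (x - y)\<bar> \<le> norm (x - y)" by (rule abs_Re_le_cmod)
      hence "Re x / 2 \<le> Re y" using that by (auto simp: dist_norm)
      hence "pi * (Re x / 2) * real (Suc n) ^ 2 \<le> pi * Re y * real (Suc n) ^ 2"
        by (intro mult_right_mono mult_left_mono) auto
      thus ?thesis unfolding norm_theta_moment_term norm_of_real by (simp add: abs_mult del: of_nat_Suc)
    qed
    hence "\<forall>\<^sub>F n in sequentially. \<forall>y\<in>ball x (Re x / 2) \<inter> ?S. norm (?f j n y) \<le> norm (?h n)"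
      by (intro always_eventually allI ballI)
    ultimately show "\<exists>d h. 0 < d \<and> summable h \<and> range h \<subseteq> \<real>\<^sub>\<ge>\<^sub>0 \<and>
        (\<forall>\<^sub>F n in sequentially. \<forall>y\<in>ball x d \<inter> ?S. cmod (?f j n y) \<le> cmod (h n))"
      using x by (intro exI[of _ "Re x / 2"] exI[of _ ?h] conjI) simp
  qed
  then obtain g g' where g: "\<And>x. x \<in> ?S \<Longrightarrow> (\<lambda>n. ?f j n x) sums g x"
    "\<And>x. x \<in> ?S \<Longrightarrow> (\<lambda>n. - of_real pi * ?f (Suc j) n x) sums g' x"
    "\<And>x. x \<in> ?S \<Longrightarrow> (g has_field_derivative g' x) (at x)" by blast
  have "g' z = - of_real pi * theta_moment (Suc j) z"
    using sums_mult[OF theta_moment_sums[OF z, of "Suc j"], of "- of_real pi"] g(2)[of z] z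
    by (metis (mono_tags, lifting) mem_Collect_eq sums_unique2)
  hence "(g has_field_derivative - of_real pi * theta_moment (Suc j) z) (at z)" using g(3)[of z] z by simp
  moreover have "g x = theta_moment j x" if "x \<in> ?S" for x
    using g(1)[OF that] theta_moment_sums[of x j] that sums_unique2 by blast
  ultimately show ?thesis
    using z by (elim has_field_derivative_transform_within_open[OF _ open_Re_pos]) auto
qed

lemma theta00_eq_moment:
  assumes \<tau>: "Im \<tau> > 0"
  shows "theta00 \<tau> = 1 + 2 * theta_moment 0 (\<tau> / \<i>)"
proof -
  let ?f = "\<lambda>n :: int. exp (\<i> * of_real pi * of_int n ^ 2 * \<tau>)"
  have z: "Re (\<tau> / \<i>) > 0" using \<tau> by (simp add: Re_divide)
  have term_eq: "of_nat (Suc n) ^ (2 * 0) * exp (- (of_real pi * of_nat (Suc n) ^ 2 * (\<tau> / \<i>))) = ?f (int (Suc n))" for n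
    by (simp add: divide_i algebra_simps)
  have hs: "((\<lambda>n. ?f (int (Suc n))) has_sum theta_moment 0 (\<tau> / \<i>)) UNIV"
    using norm_summable_imp_has_sum[OF summable_norm_theta_moment[OF z, of 0] theta_moment_sums[OF z, of 0]]
    unfolding term_eq .
  have pos: "(?f has_sum theta_moment 0 (\<tau> / \<i>)) {1..}"
  proof (rule iffD1[OF has_sum_reindex_bij_betw[where g = "\<lambda>n. int (Suc n)" and A = UNIV and B = "{1..}"] hs])
    show "bij_betw (\<lambda>n. int (Suc n)) UNIV {1..}"
      by (rule bij_betwI[of _ _ _ "\<lambda>k. nat k - 1"]) auto
  qed
  have neg: "(?f has_sum theta_moment 0 (\<tau> / \<i>)) {..-1}"
  proof (rule iffD1[OF has_sum_reindex_bij_betw[where g = "\<lambda>k. - k" and A = "{1..}" and B = "{..-1}"]])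
    show "bij_betw (\<lambda>k. - k) {1 :: int..} {..-1}"
      by (rule bij_betwI[of _ _ _ "\<lambda>k. - k"]) auto
  qed (use pos in simp)
  have zero: "(?f has_sum 1) {0}" using has_sum_finite[of "{0}" ?f] by simp
  have "(?f has_sum ((theta_moment 0 (\<tau> / \<i>) + theta_moment 0 (\<tau> / \<i>)) + 1)) (({1..} \<union> {..-1}) \<union> {0})"
    by (intro has_sum_Un_disjoint pos neg zero) auto
  moreover have "({1..} \<union> {..-1}) \<union> {0} = (UNIV :: int set)" by auto
  ultimately have "(?f has_sum ((theta_moment 0 (\<tau> / \<i>) + theta_moment 0 (\<tau> / \<i>)) + 1)) UNIV" by simp
  thus ?thesis unfolding theta00_def by (simp add: infsumI)
qed

lemma Theta00_eq_moments:
  assumes z: "Re z > 0"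
  shows "Theta00 (\<i> * z) = z powr (1/4) *
     (2 * of_real pi ^ 2 * z\<^sup>2 * theta_moment 2 z - 3 * of_real pi * z * theta_moment 1 z)"
proof -
  let ?H = "{\<tau>. Im \<tau> > 0}"
  have H: "open ?H" by (rule open_halfspace_Im_gt)
  have dM: "((\<lambda>\<tau>. c * theta_moment j (\<tau> / \<i>)) has_field_derivative
      (c * (- of_real pi / \<i>)) * theta_moment (Suc j) (\<tau> / \<i>)) (at \<tau>)" if "\<tau> \<in> ?H" for c j \<tau>
  proof -
    have "Re (\<tau> / \<i>) > 0" using that by (simp add: Re_divide)
    from has_field_derivative_theta_moment[OF this, of j]
    have "((\<lambda>\<tau>. theta_moment j (\<tau> / \<i>)) has_field_derivative
       (- of_real pi * theta_moment (Suc j) (\<tau> / \<i>)) * (1 / \<i>)) (at \<tau>)"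
      by (rule DERIV_chain2) (auto intro!: derivative_eq_intros)
    from DERIV_cmult[OF this, of c] show ?thesis by (simp add: mult_ac)
  qed
  have d1: "deriv theta00 \<tau> = (2 * (- of_real pi / \<i>)) * theta_moment 1 (\<tau> / \<i>)" if "\<tau> \<in> ?H" for \<tau>
  proof (rule DERIV_imp_deriv)
    have "((\<lambda>\<tau>. 1 + 2 * theta_moment 0 (\<tau> / \<i>)) has_field_derivative
       0 + (2 * (- of_real pi / \<i>)) * theta_moment (Suc 0) (\<tau> / \<i>)) (at \<tau>)"
      by (intro DERIV_add DERIV_const dM that)
    hence "(theta00 has_field_derivative
       0 + (2 * (- of_real pi / \<i>)) * theta_moment (Suc 0) (\<tau> / \<i>)) (at \<tau>)"
      by (rule has_field_derivative_transform_within_open[OF _ H that]) (simp add: theta00_eq_moment)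
    thus "(theta00 has_field_derivative (2 * (- of_real pi / \<i>)) * theta_moment 1 (\<tau> / \<i>)) (at \<tau>)" by simp
  qed
  have d2: "deriv (deriv theta00) \<tau> = (2 * (- of_real pi / \<i>) * (- of_real pi / \<i>)) * theta_moment 2 (\<tau> / \<i>)"
    if "\<tau> \<in> ?H" for \<tau>
  proof (rule DERIV_imp_deriv)
    have "(deriv theta00 has_field_derivative
       (2 * (- of_real pi / \<i>) * (- of_real pi / \<i>)) * theta_moment (Suc 1) (\<tau> / \<i>)) (at \<tau>)"
      by (rule has_field_derivative_transform_within_open[OF dM H that]) (use that in \<open>simp_all add: d1\<close>)
    thus "(deriv theta00 has_field_derivative
       (2 * (- of_real pi / \<i>) * (- of_real pi / \<i>)) * theta_moment 2 (\<tau> / \<i>)) (at \<tau>)"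
      by (simp add: numeral_2_eq_2)
  qed
  have "\<i> * z \<in> ?H" using z by simp
  thus ?thesis
    unfolding Theta00_def by (simp add: d1 d2) (simp add: power2_eq_square algebra_simps)
qed

text \<open>The values of the moments on the positive real axis, where signs and monotonicity are available.\<close>
definition real_theta_moment :: "nat \<Rightarrow> real \<Rightarrow> real" where
  "real_theta_moment j y = (\<Sum>n. real (Suc n) ^ (2 * j) * exp (- (pi * y * real (Suc n) ^ 2)))"

lemma real_theta_moment_sums:
  assumes "y > 0"
  shows "(\<lambda>n. real (Suc n) ^ (2 * j) * exp (- (pi * y * real (Suc n) ^ 2))) sums real_theta_moment j y"
  unfolding real_theta_moment_def using assms by (intro summable_sums summable_moment_exp_square) simp

lemma theta_moment_of_real:
  assumes "y > 0"
  shows "theta_moment j (of_real y) = of_real (real_theta_moment j y)"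
proof (rule sums_unique2)
  show "(\<lambda>n. of_nat (Suc n) ^ (2 * j) * exp (- (complex_of_real pi * of_nat (Suc n) ^ 2 * of_real y))) sums theta_moment j (of_real y)"
    using assms by (intro theta_moment_sums) simp
  have "(\<lambda>n. complex_of_real (real (Suc n) ^ (2 * j) * exp (- (pi * y * real (Suc n) ^ 2)))) sums of_real (real_theta_moment j y)"
    by (intro sums_of_real real_theta_moment_sums assms)
  thus "(\<lambda>n. of_nat (Suc n) ^ (2 * j) * exp (- (complex_of_real pi * of_nat (Suc n) ^ 2 * of_real y))) sums of_real (real_theta_moment j y)"
    by (simp add: exp_of_real [symmetric] mult_ac del: of_nat_Suc)
qed

lemma has_real_derivative_real_theta_moment:
  assumes y: "y > 0"
  shows "(real_theta_moment j has_real_derivative - pi * real_theta_moment (Suc j) y) (at y)"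
proof -
  have "(theta_moment j has_field_derivative - of_real pi * theta_moment (Suc j) (of_real y)) (at (of_real y))"
    using y by (intro has_field_derivative_theta_moment) simp
  hence "((\<lambda>y. theta_moment j (of_real y)) has_vector_derivative - of_real pi * theta_moment (Suc j) (of_real y)) (at y)"
    by (rule has_vector_derivative_real_field)
  hence "((\<lambda>y. Re (theta_moment j (of_real y))) has_vector_derivative Re (- of_real pi * theta_moment (Suc j) (of_real y))) (at y)"
    by (rule bounded_linear.has_vector_derivative[OF bounded_linear_Re])
  hence "((\<lambda>y. Re (theta_moment j (of_real y))) has_real_derivative - pi * real_theta_moment (Suc j) y) (at y)"
    using y by (simp add: theta_moment_of_real has_real_derivative_iff_has_vector_derivative)
  thus ?thesis
    by (rule has_field_derivative_transform_within_open[of _ _ _ "{0<..}"]) (use y in \<open>auto simp: theta_moment_of_real\<close>)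
qed

section \<open>Polya's kernel\<close>

text \<open>\<open>Theta00 (i t\<^sup>2)\<close> in the variable \<open>x = log t\<close>: up to normalisation, the kernel of Riemann's integral for \<open>\<Xi>\<close> that
Polya studied.\<close>
definition polya_kernel :: "real \<Rightarrow> real" where
  "polya_kernel x = exp (x / 2) * (2 * pi\<^sup>2 * exp (4 * x) * real_theta_moment 2 (exp (2 * x))
     - 3 * pi * exp (2 * x) * real_theta_moment 1 (exp (2 * x)))"

lemma Theta00_exp: "Theta00 (\<i> * of_real ((exp x)\<^sup>2)) = of_real (polya_kernel x)"
proof -
  have e: "(exp x)\<^sup>2 = exp (2 * x)" for x :: real by (simp add: exp_double)
  have "exp (2 * x) powr (1/4) = exp (x / 2)" by (simp add: powr_def)
  hence "complex_of_real (exp (2 * x)) powr (1/4) = of_real (exp (x / 2))"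
    using powr_of_real[of "exp (2 * x)" "1/4"] by simp
  moreover have "(complex_of_real (exp (2 * x)))\<^sup>2 = of_real (exp (4 * x))"
    using e[of "2 * x"] by (simp flip: of_real_power)
  moreover have "Re (complex_of_real (exp (2 * x))) > 0" by simp
  ultimately show ?thesis
    unfolding e polya_kernel_def
    by (subst Theta00_eq_moments) (simp_all add: theta_moment_of_real del: exp_of_real of_real_exp)
qed

lemma polya_kernel_sums:
  "(\<lambda>n. exp (x / 2) * (2 * pi\<^sup>2 * exp (4 * x) * real (Suc n) ^ 4 - 3 * pi * exp (2 * x) * real (Suc n) ^ 2)
      * exp (- (pi * exp (2 * x) * real (Suc n) ^ 2))) sums polya_kernel x"
proof -
  have "(\<lambda>n. exp (x / 2) * (2 * pi\<^sup>2 * exp (4 * x) * (real (Suc n) ^ (2 * 2) * exp (- (pi * exp (2 * x) * real (Suc n) ^ 2)))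
      - 3 * pi * exp (2 * x) * (real (Suc n) ^ (2 * 1) * exp (- (pi * exp (2 * x) * real (Suc n) ^ 2))))) sums polya_kernel x"
    unfolding polya_kernel_def
    by (intro sums_mult sums_diff real_theta_moment_sums) simp_all
  thus ?thesis by (rule sums_cong[THEN iffD1, rotated]) (simp add: algebra_simps power2_eq_square power4_eq_xxxx del: of_nat_Suc)
qed

text \<open>\<open>t\<^sup>1\<^sup>/\<^sup>2 theta00 (i t\<^sup>2)\<close> with \<open>t = e\<^sup>x\<close>. The weight \<open>t\<^sup>1\<^sup>/\<^sup>2\<close> turns the inversion \<open>t \<mapsto> 1/t\<close> into evenness in \<open>x\<close>.\<close>
definition even_theta :: "real \<Rightarrow> real" where
  "even_theta x = exp (x / 2) * (1 + 2 * real_theta_moment 0 (exp (2 * x)))"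

lemma even_theta_minus: "even_theta (- x) = even_theta x"
proof -
  have sqrt_exp: "sqrt (exp (2 * x)) = exp x" by (rule real_sqrt_unique) (simp_all add: exp_double)
  have inv: "exp (2 * (- x)) = 1 / exp (2 * x)" by (simp add: exp_minus divide_inverse)
  have "1 + 2 * real_theta_moment 0 (1 / exp (2 * x)) = exp x * (1 + 2 * real_theta_moment 0 (exp (2 * x)))"
    using jacobi_theta_inversion[of "exp (2 * x)"] unfolding real_theta_moment_def sqrt_exp
    by (simp add: mult_ac)
  thus ?thesis unfolding even_theta_def inv by (simp add: mult.assoc[symmetric] flip: exp_add)
qed

lemma even_theta_deriv:
  "(even_theta has_real_derivative
      even_theta x / 2 - 4 * pi * exp (5 * x / 2) * real_theta_moment 1 (exp (2 * x))) (at x)"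
proof -
  have "((\<lambda>x. exp (x / 2) * (1 + 2 * real_theta_moment 0 (exp (2 * x)))) has_real_derivative
     exp (x / 2) / 2 * (1 + 2 * real_theta_moment 0 (exp (2 * x)))
     + exp (x / 2) * (2 * (- pi * real_theta_moment (Suc 0) (exp (2 * x)) * (exp (2 * x) * 2)))) (at x)"
    by (auto intro!: derivative_eq_intros DERIV_chain2[OF has_real_derivative_real_theta_moment])
  moreover have "exp (5 * x / 2) = exp (x / 2) * exp (2 * x)" by (simp add: field_simps flip: exp_add)
  hence "exp (x / 2) / 2 * (1 + 2 * real_theta_moment 0 (exp (2 * x)))
     + exp (x / 2) * (2 * (- pi * real_theta_moment (Suc 0) (exp (2 * x)) * (exp (2 * x) * 2)))
     = even_theta x / 2 - 4 * pi * exp (5 * x / 2) * real_theta_moment 1 (exp (2 * x))"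
    by (simp add: even_theta_def)
  ultimately show ?thesis unfolding even_theta_def[abs_def] by (rule DERIV_cong)
qed

text \<open>The operator \<open>d\<^sup>2/dx\<^sup>2 - 1/4\<close> annihilates the constant term \<open>e\<^sup>x\<^sup>/\<^sup>2\<close> of the weighted theta series and leaves four
times Polya's kernel.\<close>
lemma even_theta_deriv2:
  "((\<lambda>x. even_theta x / 2 - 4 * pi * exp (5 * x / 2) * real_theta_moment 1 (exp (2 * x)))
      has_real_derivative even_theta x / 4 + 4 * polya_kernel x) (at x)"
proof -
  let ?T = "\<lambda>j. real_theta_moment j (exp (2 * x))"
  have "((\<lambda>x. even_theta x / 2 - 4 * pi * exp (5 * x / 2) * real_theta_moment 1 (exp (2 * x))) has_real_derivative
     (even_theta x / 2 - 4 * pi * exp (5 * x / 2) * ?T 1) / 2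
     - (4 * pi * (exp (5 * x / 2) * (5 / 2)) * ?T 1
        + 4 * pi * exp (5 * x / 2) * (- pi * ?T (Suc 1) * (exp (2 * x) * 2)))) (at x)"
    by (auto intro!: derivative_eq_intros even_theta_deriv DERIV_chain2[OF has_real_derivative_real_theta_moment])
  moreover have "exp (5 * x / 2) = exp (x / 2) * exp (2 * x)" "exp (4 * x) = exp (2 * x) * exp (2 * x)"
    by (simp_all add: field_simps flip: exp_add)
  hence "(even_theta x / 2 - 4 * pi * exp (5 * x / 2) * ?T 1) / 2
     - (4 * pi * (exp (5 * x / 2) * (5 / 2)) * ?T 1
        + 4 * pi * exp (5 * x / 2) * (- pi * ?T (Suc 1) * (exp (2 * x) * 2)))
     = even_theta x / 4 + 4 * polya_kernel x"
    unfolding polya_kernel_def by (simp add: field_simps power2_eq_square numeral_2_eq_2)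
  ultimately show ?thesis by (rule DERIV_cong)
qed

text \<open>If \<open>G\<close> is the even function \<open>even_theta\<close>, then \<open>4 polya_kernel = G'' - G/4\<close>, and the second
derivative of an even function is even.\<close>
lemma polya_kernel_minus: "polya_kernel (- x) = polya_kernel x"
proof -
  define G1 where "G1 x = even_theta x / 2 - 4 * pi * exp (5 * x / 2) * real_theta_moment 1 (exp (2 * x))" for x
  have d1: "(even_theta has_real_derivative G1 x) (at x)" for x
    unfolding G1_def by (rule even_theta_deriv)
  have d2: "(G1 has_real_derivative even_theta x / 4 + 4 * polya_kernel x) (at x)" for x
    unfolding G1_def by (rule even_theta_deriv2)
  have odd: "G1 (- x) = - G1 x" for x
  proof -
    have "((\<lambda>x. even_theta (- x)) has_real_derivative G1 (- x) * (- 1)) (at x)"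
      by (rule DERIV_chain2[OF d1]) (auto intro!: derivative_eq_intros)
    with d1[of x] have "G1 (- x) * (- 1) = G1 x" unfolding even_theta_minus by (rule DERIV_unique[rotated])
    thus ?thesis by simp
  qed
  have "((\<lambda>x. G1 (- x)) has_real_derivative (even_theta (- x) / 4 + 4 * polya_kernel (- x)) * (- 1)) (at x)"
    by (rule DERIV_chain2[OF d2]) (auto intro!: derivative_eq_intros)
  moreover have "((\<lambda>x. - G1 x) has_real_derivative - (even_theta x / 4 + 4 * polya_kernel x)) (at x)"
    by (intro DERIV_minus d2)
  ultimately have "(even_theta (- x) / 4 + 4 * polya_kernel (- x)) * (- 1) = - (even_theta x / 4 + 4 * polya_kernel x)"
    unfolding odd by (rule DERIV_unique)
  thus ?thesis by (simp add: even_theta_minus)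
qed

lemma polya_kernel_abs: "polya_kernel \<bar>x\<bar> = polya_kernel x"
  by (simp add: abs_if polya_kernel_minus)

text \<open>For \<open>x \<ge> 0\<close> every term of the series is positive since \<open>2 \<pi> > 3\<close>; evenness gives the rest.\<close>
lemma polya_kernel_pos: "polya_kernel x > 0"
proof -
  define y where "y = exp (2 * \<bar>x\<bar>)"
  have y: "y \<ge> 1" by (simp add: y_def)
  have "exp (4 * \<bar>x\<bar>) = y * y" by (simp add: y_def flip: exp_add)
  hence sums: "(\<lambda>n. exp (\<bar>x\<bar> / 2) * (2 * pi\<^sup>2 * (y * y) * real (Suc n) ^ 4 - 3 * pi * y * real (Suc n) ^ 2)
      * exp (- (pi * y * real (Suc n) ^ 2))) sums polya_kernel \<bar>x\<bar>"
    using polya_kernel_sums[of "\<bar>x\<bar>"] by (simp add: y_def)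
  have pos: "exp (\<bar>x\<bar> / 2) * (2 * pi\<^sup>2 * (y * y) * real (Suc n) ^ 4 - 3 * pi * y * real (Suc n) ^ 2)
      * exp (- (pi * y * real (Suc n) ^ 2)) > 0" for n
  proof -
    have n2: "real (Suc n) ^ 2 \<ge> 1" by simp
    have "3 < 2 * pi" using pi_gt3 by simp
    also have "\<dots> \<le> 2 * pi * (y * real (Suc n) ^ 2)"
      using mult_mono[OF y n2] y by simp
    finally have "2 * pi * (y * real (Suc n) ^ 2) - 3 > 0" by simp
    hence "pi * y * real (Suc n) ^ 2 * (2 * pi * (y * real (Suc n) ^ 2) - 3) > 0" using y by simp
    also have "pi * y * real (Suc n) ^ 2 * (2 * pi * (y * real (Suc n) ^ 2) - 3)
       = 2 * pi\<^sup>2 * (y * y) * real (Suc n) ^ 4 - 3 * pi * y * real (Suc n) ^ 2"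
      by (simp add: algebra_simps power2_eq_square power4_eq_xxxx del: of_nat_Suc)
    finally show ?thesis by simp
  qed
  have "polya_kernel \<bar>x\<bar> > 0"
    using suminf_pos[OF sums_summable[OF sums] pos] sums_unique[OF sums] by simp
  thus ?thesis by (simp add: polya_kernel_abs)
qed

text \<open>With \<open>y = e\<^sup>2\<^sup>x \<ge> 1\<close>, the estimate \<open>\<pi> n\<^sup>2 y \<ge> 2 n\<^sup>2 + y\<close> splits off a factor \<open>e\<^sup>-\<^sup>y\<close> from every term, and
\<open>e\<^sup>-\<^sup>y \<le> k! / y\<^sup>k\<close> beats any exponential in \<open>x\<close>.\<close>
lemma polya_kernel_bound:
  obtains K where "K > 0" "\<And>x. polya_kernel x \<le> K * exp (- (real N * \<bar>x\<bar>))"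
proof
  define A where "A = (\<Sum>n. real (Suc n) ^ 4 * exp (- (2 * real (Suc n) ^ 2)))"
  \<comment> \<open>The prefactor of the second moment is \<open>e\<^sup>9\<^sup>x\<^sup>/\<^sup>2\<close>; with \<open>k = N + 5\<close>, the factor \<open>y\<^sup>-\<^sup>k\<close> absorbs it and leaves at least \<open>e\<^sup>-\<^sup>N\<^sup>x\<close>.\<close>
  define K where "K = 2 * pi\<^sup>2 * A * fact (N + 5)"
  have summ: "summable (\<lambda>n. real (Suc n) ^ 4 * exp (- (2 * real (Suc n) ^ 2)))"
    using summable_moment_exp_square[of 2 2] by simp
  have "A > 0" unfolding A_def by (rule suminf_pos[OF summ]) simp
  thus "K > 0" by (simp add: K_def)
  have bound: "polya_kernel x \<le> K * exp (- (real N * x))" if x: "x \<ge> 0" for x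
  proof -
    define y where "y = exp (2 * x)"
    have y: "y \<ge> 1" using x by (simp add: y_def)
    have "real_theta_moment 2 y \<le> A * exp (- y)"
    proof (rule sums_le)
      show "(\<lambda>n. real (Suc n) ^ (2 * 2) * exp (- (pi * y * real (Suc n) ^ 2))) sums real_theta_moment 2 y"
        using y by (intro real_theta_moment_sums) simp
      show "(\<lambda>n. real (Suc n) ^ 4 * exp (- (2 * real (Suc n) ^ 2)) * exp (- y)) sums (A * exp (- y))"
        unfolding A_def by (intro sums_mult2 summable_sums summ)
      fix n
      define q where "q = real (Suc n) ^ 2"
      have q: "q \<ge> 1" by (simp add: q_def)
      have "3 * (y * q) \<le> pi * (y * q)" using pi_gt3 y q by (intro mult_right_mono) auto
      moreover have "y * q \<ge> y" "y * q \<ge> q" using y q by (simp_all add: mult_le_cancel_left1 mult_le_cancel_right1)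
      ultimately have "2 * q + y \<le> pi * y * q" by (simp add: mult.assoc)
      hence "exp (- (pi * y * q)) \<le> exp (- (2 * q)) * exp (- y)" by (simp flip: exp_add)
      thus "real (Suc n) ^ (2 * 2) * exp (- (pi * y * real (Suc n) ^ 2))
          \<le> real (Suc n) ^ 4 * exp (- (2 * real (Suc n) ^ 2)) * exp (- y)"
        by (simp add: q_def mult.assoc mult_left_mono)
    qed
    also have "exp (- y) \<le> fact (N + 5) / y ^ (N + 5)"
      using power_div_fact_le_exp[of y "N + 5"] y by (simp add: exp_minus field_simps del: fact_Suc)
    also have "y ^ (N + 5) = exp (2 * x * real (N + 5))"
      by (simp add: y_def mult.commute flip: exp_of_nat_mult)
    finally have th: "real_theta_moment 2 y \<le> A * (fact (N + 5) / exp (2 * x * real (N + 5)))"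
      using \<open>A > 0\<close> by (simp add: mult_left_mono)
    have "real_theta_moment 1 y \<ge> 0"
      using sums_le[OF _ sums_zero real_theta_moment_sums[of y 1]] y by simp
    hence "polya_kernel x \<le> exp (x / 2) * (2 * pi\<^sup>2 * exp (4 * x) * real_theta_moment 2 y)"
      unfolding polya_kernel_def y_def by (intro mult_left_mono) auto
    also have "\<dots> \<le> exp (x / 2) * (2 * pi\<^sup>2 * exp (4 * x) * (A * (fact (N + 5) / exp (2 * x * real (N + 5)))))"
      by (intro mult_left_mono th) auto
    also have "\<dots> = K * exp (x / 2 + 4 * x - 2 * x * real (N + 5))"
      unfolding K_def exp_diff exp_add by (simp add: mult_ac)
    also have "\<dots> \<le> K * exp (- (real N * x))"
    proof (intro mult_left_mono)
      have "x * (9 / 2 - 2 * real (N + 5) + real N) \<le> 0" using x by (intro mult_nonneg_nonpos) auto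
      thus "exp (x / 2 + 4 * x - 2 * x * real (N + 5)) \<le> exp (- (real N * x))"
        by (simp add: algebra_simps)
    qed (use \<open>K > 0\<close> in simp)
    finally show ?thesis .
  qed
  show "polya_kernel x \<le> K * exp (- (real N * \<bar>x\<bar>))" for x
    using bound[of "\<bar>x\<bar>"] by (simp add: polya_kernel_abs)
qed

lemma continuous_polya_kernel: "continuous_on A polya_kernel"
proof -
  have "continuous_on {0<..} (real_theta_moment j)" for j
    by (intro continuous_at_imp_continuous_on ballI DERIV_isCont[OF has_real_derivative_real_theta_moment]) auto
  hence "continuous_on A (\<lambda>x. real_theta_moment j (exp (2 * x)))" for j
    by (rule continuous_on_compose2) (auto intro!: continuous_intros)
  thus ?thesis unfolding polya_kernel_def[abs_def] by (intro continuous_intros) auto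
qed

section \<open>The entire transform of the kernel\<close>

text \<open>Euler's integral for \<open>\<Gamma>(z)\<close> after the substitution \<open>t = a e\<^sup>2\<^sup>x\<close>.\<close>
lemma Mellin_transform_exp:
  fixes z :: complex and a :: real
  assumes z: "Re z > 0" and a: "a > 0"
  shows "has_bochner_integral lborel (\<lambda>x. exp (2 * z * of_real x - of_real (a * exp (2 * x))))
           (Gamma z / (2 * of_real a powr z))"
proof -
  define f where "f t = complex_of_real t powr (z - 1) / of_real (exp t)" for t :: real
  define g where "g x = a * exp (2 * x)" for x :: real
  define E where "E x = exp (2 * z * of_real x - of_real (a * exp (2 * x)))" for x :: real
  have g_image: "g ` UNIV = {0<..}"
  proof (intro equalityI subsetI)
    fix t :: real assume "t \<in> {0<..}"
    hence "t = g (ln (t / a) / 2)" using a by (simp add: g_def)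
    thus "t \<in> g ` UNIV" by blast
  qed (auto simp: g_def a)
  have "(\<lambda>x. \<bar>2 * g x\<bar> *\<^sub>R f (g x)) absolutely_integrable_on UNIV \<and>
        integral UNIV (\<lambda>x. \<bar>2 * g x\<bar> *\<^sub>R f (g x)) = Gamma z"
  proof (subst has_absolute_integral_change_of_variables_real)
    show "(g has_real_derivative 2 * g x) (at x within UNIV)" for x
      unfolding g_def by (auto intro!: derivative_eq_intros)
    show "inj_on g UNIV" using a by (auto simp: g_def inj_on_def)
    show "f absolutely_integrable_on g ` UNIV \<and> integral (g ` UNIV) f = Gamma z"
      unfolding g_image f_def
      using absolutely_integrable_Gamma_integral'[OF z] integral_unique[OF Gamma_integral_complex'[OF z]] by simp
  qed simp
  moreover have "\<bar>2 * g x\<bar> *\<^sub>R f (g x) = (2 * of_real a powr z) * E x" for x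
  proof -
    have gx: "g x > 0" using a by (simp add: g_def)
    have powr_exp: "complex_of_real (exp (2 * x)) powr z = exp (2 * z * of_real x)"
      by (simp add: powr_def Ln_of_real mult_ac del: of_real_exp exp_of_real flip: exp_of_real)
    have "complex_of_real (g x) powr z = (complex_of_real a * complex_of_real (exp (2 * x))) powr z"
      by (simp only: g_def of_real_mult)
    also have "\<dots> = complex_of_real a powr z * complex_of_real (exp (2 * x)) powr z"
      by (rule powr_times_real_left) (use a in simp_all)
    finally have powr_g: "complex_of_real (g x) powr z = of_real a powr z * exp (2 * z * of_real x)"
      by (simp only: powr_exp)
    have "of_real (2 * g x) * f (g x) = 2 * (of_real (g x) * complex_of_real (g x) powr (z - 1)) / exp (of_real (g x))"
      by (simp add: f_def exp_of_real)
    also have "of_real (g x) * complex_of_real (g x) powr (z - 1) = complex_of_real (g x) powr z"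
      using gx by (simp add: powr_diff)
    also have "2 * \<dots> / exp (of_real (g x)) = (2 * of_real a powr z) * E x"
      unfolding powr_g unfolding E_def g_def exp_diff by (simp add: exp_of_real)
    finally show ?thesis using gx by (simp add: scaleR_conv_of_real)
  qed
  ultimately have E: "(\<lambda>x. (2 * of_real a powr z) * E x) absolutely_integrable_on UNIV"
    "integral UNIV (\<lambda>x. (2 * of_real a powr z) * E x) = Gamma z" by simp_all
  have nz: "2 * complex_of_real a powr z \<noteq> 0" using a by simp
  have "integrable lebesgue (\<lambda>x. (2 * of_real a powr z) * E x)"
    using E(1) by (simp add: set_integrable_def)
  hence "integrable lebesgue (\<lambda>x. inverse (2 * of_real a powr z) * ((2 * of_real a powr z) * E x))"
    by (rule integrable_mult_right)
  hence "integrable lebesgue E" using nz unfolding mult.assoc[symmetric] by simp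
  moreover have "E \<in> borel_measurable borel"
    unfolding E_def by (intro borel_measurable_continuous_onI continuous_intros)
  ultimately have int: "integrable lborel E" by (simp add: integrable_completion)
  have "(2 * of_real a powr z) * integral\<^sup>L lborel E = Gamma z"
    using E(2) has_integral_integral_lborel[OF int] by (simp add: integral_unique)
  hence "integral\<^sup>L lborel E = Gamma z / (2 * of_real a powr z)"
    using nz by (simp add: field_simps)
  with int show ?thesis unfolding E_def has_bochner_integral_iff by simp
qed

text \<open>A majorant for the integrals over the line. Up to the factor \<open>e\<close>, it is bounded on each half line by the Gamma
integrand \<open>exp (2x - e\<^sup>2\<^sup>x)\<close> or by its reflection.\<close>
lemma integrable_exp_minus_abs: "integrable lborel (\<lambda>x :: real. exp (- (2 * \<bar>x\<bar>)))"
proof -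
  define h where "h x = exp (2 * x - exp (2 * x))" for x :: real
  have "integrable lborel (\<lambda>x. exp (2 * 1 * complex_of_real x - of_real (1 * exp (2 * x))))"
    using Mellin_transform_exp[of 1 1] by (auto simp: has_bochner_integral_iff)
  from integrable_norm[OF this] have h: "integrable lborel h" by (simp add: h_def[abs_def])
  hence "integrable lborel (\<lambda>x. h (0 + (-1) * x))" by (rule lborel_integrable_real_affine) simp
  with h have "integrable lborel (\<lambda>x. exp 1 * (h x + h (- x)))" by simp
  thus ?thesis
  proof (rule Bochner_Integration.integrable_bound)
    have le: "exp (2 * y) \<le> exp 1 * h y" if "y \<le> 0" for y
      using that by (simp add: h_def flip: exp_add)
    have "exp (- (2 * \<bar>x\<bar>)) \<le> exp 1 * (h x + h (- x))" for x
    proof -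
      have "exp (- (2 * \<bar>x\<bar>)) \<le> exp 1 * h (- \<bar>x\<bar>)" using le[of "- \<bar>x\<bar>"] by simp
      also have "\<dots> \<le> exp 1 * (h x + h (- x))" by (auto simp: abs_if h_def)
      finally show ?thesis .
    qed
    thus "AE x in lborel. norm (exp (- (2 * \<bar>x\<bar>))) \<le> norm (exp 1 * (h x + h (- x)))"
      by (intro AE_I2) (simp add: order.trans[OF _ abs_ge_self])
  qed simp
qed

definition kernel_transform :: "complex \<Rightarrow> complex" where
  "kernel_transform w = (\<integral>x. exp (w * of_real x) * of_real (polya_kernel x) \<partial>lborel)"

lemma kernel_transform_integrand_measurable [measurable]:
  "(\<lambda>x. exp (w * of_real x) * complex_of_real (polya_kernel x)) \<in> borel_measurable borel"
  by (intro borel_measurable_continuous_onI continuous_intros continuous_polya_kernel)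

text \<open>Of the factor \<open>e\<^sup>-\<^sup>3\<^sup>\<bar>\<^sup>x\<^sup>\<bar>\<close>, the part \<open>e\<^sup>-\<^sup>2\<^sup>\<bar>\<^sup>x\<^sup>\<bar>\<close> serves as integrable majorant, and the rest makes the tails of the integral
small, uniformly for \<open>w\<close> in a vertical strip.\<close>
lemma kernel_transform_integrand_bound:
  obtains K where "K > 0"
    "\<And>w x. \<bar>Re w\<bar> \<le> R \<Longrightarrow> norm (exp (w * of_real x) * complex_of_real (polya_kernel x)) \<le> K * exp (- (3 * \<bar>x\<bar>))"
proof -
  obtain N :: nat where N: "R + 3 \<le> real N" using real_arch_simple by blast
  obtain K where K: "K > 0" "\<And>x. polya_kernel x \<le> K * exp (- (real N * \<bar>x\<bar>))"
    using polya_kernel_bound by blast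
  show ?thesis
  proof (rule that[OF K(1)])
    fix w :: complex and x :: real assume w: "\<bar>Re w\<bar> \<le> R"
    have "Re w * x \<le> R * \<bar>x\<bar>"
      using mult_right_mono[OF w, of "\<bar>x\<bar>"] abs_ge_self[of "Re w * x"] by (simp add: abs_mult)
    moreover have "(R + 3) * \<bar>x\<bar> \<le> real N * \<bar>x\<bar>" using N by (intro mult_right_mono) auto
    ultimately have "Re w * x - real N * \<bar>x\<bar> \<le> - (3 * \<bar>x\<bar>)" by (simp add: algebra_simps)
    hence e: "exp (Re w * x) * exp (- (real N * \<bar>x\<bar>)) \<le> exp (- (3 * \<bar>x\<bar>))" by (simp flip: exp_add)
    have "norm (exp (w * of_real x) * complex_of_real (polya_kernel x)) = exp (Re w * x) * polya_kernel x"
      using polya_kernel_pos[of x] by (simp add: norm_mult)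
    also have "\<dots> \<le> exp (Re w * x) * (K * exp (- (real N * \<bar>x\<bar>)))"
      by (intro mult_left_mono K) simp
    also have "\<dots> \<le> K * exp (- (3 * \<bar>x\<bar>))"
      using mult_left_mono[OF e, of K] K(1) by (simp add: mult_ac)
    finally show "norm (exp (w * of_real x) * complex_of_real (polya_kernel x)) \<le> K * exp (- (3 * \<bar>x\<bar>))" .
  qed
qed

lemma integrable_kernel_transform:
  "integrable lborel (\<lambda>x. exp (w * of_real x) * complex_of_real (polya_kernel x))"
proof -
  obtain K where K: "K > 0" "\<And>x. norm (exp (w * of_real x) * complex_of_real (polya_kernel x)) \<le> K * exp (- (3 * \<bar>x\<bar>))"
    using kernel_transform_integrand_bound[of "\<bar>Re w\<bar>"] by (metis order.refl)
  show ?thesis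
  proof (rule Bochner_Integration.integrable_bound)
    show "integrable lborel (\<lambda>x. K * exp (- (2 * \<bar>x\<bar>)))"
      by (intro integrable_mult_right integrable_exp_minus_abs)
    have "norm (exp (w * of_real x) * complex_of_real (polya_kernel x)) \<le> norm (K * exp (- (2 * \<bar>x\<bar>)))" for x
      by (rule order.trans[OF K(2)]) (use K(1) in simp)
    thus "AE x in lborel. norm (exp (w * of_real x) * complex_of_real (polya_kernel x)) \<le> norm (K * exp (- (2 * \<bar>x\<bar>)))"
      by simp
  qed simp
qed

text \<open>The integrals over \<open>[-n, n]\<close> are holomorphic by differentiation under the integral sign. The decay of
the kernel makes their tails smaller than \<open>C e\<^sup>-\<^sup>n\<close>, uniformly on discs.\<close>
lemma holomorphic_kernel_transform: "kernel_transform holomorphic_on UNIV"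
proof (rule holomorphic_uniform_sequence)
  let ?f = "\<lambda>w x. exp (w * of_real x) * complex_of_real (polya_kernel x)"
  define F where "F n w = integral (cbox (- real n) (real n)) (?f w)" for n w
  show "F n holomorphic_on UNIV" for n
    unfolding F_def
  proof (rule leibniz_rule_holomorphic)
    show "((\<lambda>w. ?f w x) has_field_derivative of_real x * ?f w x) (at w within UNIV)" for w x
      by (auto intro!: derivative_eq_intros)
    show "?f w integrable_on cbox (- real n) (real n)" for w
      by (intro integrable_continuous continuous_intros continuous_polya_kernel)
    show "continuous_on (UNIV \<times> cbox (- real n) (real n)) (\<lambda>(w, x). of_real x * ?f w x)"
      unfolding case_prod_unfold
      by (intro continuous_intros continuous_on_compose2[OF continuous_polya_kernel[of UNIV]]) auto
  qed simp
  fix w0 :: complex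
  define R where "R = \<bar>Re w0\<bar> + 1"
  obtain K where K: "K > 0" "\<And>w x. \<bar>Re w\<bar> \<le> R \<Longrightarrow> norm (?f w x) \<le> K * exp (- (3 * \<bar>x\<bar>))"
    using kernel_transform_integrand_bound[of R] by blast
  define C where "C = K * (\<integral>x. exp (- (2 * \<bar>x\<bar>)) \<partial>lborel)"
  have tail: "dist (F n w) (kernel_transform w) \<le> C * exp (- real n)" if w: "w \<in> cball w0 1" for n w
  proof -
    have "\<bar>Re (w0 - w)\<bar> \<le> 1" using abs_Re_le_cmod[of "w0 - w"] w by (simp add: dist_norm)
    hence Rw: "\<bar>Re w\<bar> \<le> R" by (simp add: R_def)
    let ?I = "{- real n..real n}"
    have int_I: "set_integrable lborel ?I (?f w)"
      unfolding set_integrable_def by (intro integrable_mult_indicator integrable_kernel_transform) simp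
    have int_C: "set_integrable lborel (- ?I) (?f w)"
      unfolding set_integrable_def by (intro integrable_mult_indicator integrable_kernel_transform) simp
    have "kernel_transform w = (\<integral>x. indicator ?I x *\<^sub>R ?f w x + indicator (- ?I) x *\<^sub>R ?f w x \<partial>lborel)"
      unfolding kernel_transform_def by (rule Bochner_Integration.integral_cong) (auto simp: indicator_def)
    also have "\<dots> = (LINT x:?I|lborel. ?f w x) + (LINT x:- ?I|lborel. ?f w x)"
      using int_I int_C unfolding set_integrable_def set_lebesgue_integral_def
      by (rule Bochner_Integration.integral_add)
    also have "(LINT x:?I|lborel. ?f w x) = F n w"
      using set_borel_integral_eq_integral(2)[OF int_I] by (simp add: F_def cbox_interval)
    finally have "dist (F n w) (kernel_transform w) = norm (LINT x:- ?I|lborel. ?f w x)"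
      by (simp add: dist_norm)
    also have "\<dots> \<le> (\<integral>x. norm (indicator (- ?I) x *\<^sub>R ?f w x) \<partial>lborel)"
      unfolding set_lebesgue_integral_def by (rule integral_norm_bound)
    also have "\<dots> \<le> (\<integral>x. (K * exp (- real n)) * exp (- (2 * \<bar>x\<bar>)) \<partial>lborel)"
    proof (rule integral_mono)
      show "integrable lborel (\<lambda>x. norm (indicator (- ?I) x *\<^sub>R ?f w x))"
        using int_C unfolding set_integrable_def by (rule integrable_norm)
      show "integrable lborel (\<lambda>x. (K * exp (- real n)) * exp (- (2 * \<bar>x\<bar>)))"
        by (intro integrable_mult_right integrable_exp_minus_abs)
      fix x :: real
      show "norm (indicator (- ?I) x *\<^sub>R ?f w x) \<le> (K * exp (- real n)) * exp (- (2 * \<bar>x\<bar>))"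
      proof (cases "x \<in> ?I")
        case False
        hence "real n \<le> \<bar>x\<bar>" by auto
        hence "exp (- (3 * \<bar>x\<bar>)) \<le> exp (- real n) * exp (- (2 * \<bar>x\<bar>))" by (simp flip: exp_add)
        hence "K * exp (- (3 * \<bar>x\<bar>)) \<le> K * (exp (- real n) * exp (- (2 * \<bar>x\<bar>)))"
          using K(1) by (intro mult_left_mono) auto
        with K(2)[OF Rw, of x] False show ?thesis by (simp add: mult.assoc)
      qed (use K(1) in simp)
    qed
    also have "\<dots> = C * exp (- real n)" by (simp add: C_def mult_ac)
    finally show ?thesis .
  qed
  have "uniform_limit (cball w0 1) F kernel_transform sequentially"
  proof (rule uniform_limitI)
    fix e :: real assume e: "e > 0"
    have "(\<lambda>n. C * exp (- real n)) \<longlonglongrightarrow> C * 0"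
      by (intro tendsto_intros filterlim_compose[OF exp_at_bot] filterlim_compose[OF filterlim_uminus_at_bot_at_top] filterlim_real_sequentially)
    hence "\<forall>\<^sub>F n in sequentially. C * exp (- real n) < e" using e by (intro order_tendstoD) auto
    thus "\<forall>\<^sub>F n in sequentially. \<forall>w\<in>cball w0 1. dist (F n w) (kernel_transform w) < e"
      by eventually_elim (intro ballI le_less_trans[OF tail])
  qed
  thus "\<exists>d>0. cball w0 d \<subseteq> UNIV \<and> uniform_limit (cball w0 d) F kernel_transform sequentially"
    by (intro exI[of _ 1]) auto
qed simp

section \<open>The zeta function as a transform of the kernel\<close>

lemma of_nat_powr_scale:
  assumes n: "n > 0"
  shows "complex_of_real (pi * real n ^ 2) powr (w / 2) = of_real pi powr (w / 2) * of_nat n powr w"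
proof -
  have "ln (pi * real n ^ 2) = ln pi + 2 * ln (real n)"
    using n by (simp add: ln_mult ln_realpow)
  hence "Ln (complex_of_real (pi * real n ^ 2)) = of_real (ln pi) + 2 * of_real (ln (real n))"
    using n by (subst Ln_of_real) simp_all
  hence "complex_of_real (pi * real n ^ 2) powr (w / 2)
       = exp (w / 2 * (of_real (ln pi) + 2 * of_real (ln (real n))))"
    using n by (simp add: powr_def)
  also have "\<dots> = exp (w / 2 * of_real (ln pi)) * exp (w * of_real (ln (real n)))"
    by (simp add: exp_add [symmetric] algebra_simps)
  also have "\<dots> = of_real pi powr (w / 2) * of_nat n powr w"
    using n Ln_of_nat[of n] Ln_of_real[of pi] by (simp add: powr_def)
  finally show ?thesis .
qed

text \<open>The contribution of \<open>n\<close> to the kernel, multiplied by \<open>e\<^sup>(\<^sup>s\<^sup>-\<^sup>1\<^sup>/\<^sup>2\<^sup>)\<^sup>x\<close> and written so that its two parts are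
Gamma integrands with parameters \<open>s/2 + 2\<close> and \<open>s/2 + 1\<close>.\<close>
definition kernel_term :: "complex \<Rightarrow> nat \<Rightarrow> real \<Rightarrow> complex" where
  "kernel_term s n x =
     2 * of_real (pi\<^sup>2 * real n ^ 4) * exp (2 * (s / 2 + 2) * of_real x - of_real (pi * real n ^ 2 * exp (2 * x)))
   - 3 * of_real (pi * real n ^ 2) * exp (2 * (s / 2 + 1) * of_real x - of_real (pi * real n ^ 2 * exp (2 * x)))"

lemma kernel_term_sums:
  "(\<lambda>n. kernel_term s (Suc n) x) sums (exp ((s - 1/2) * of_real x) * of_real (polya_kernel x))"
proof -
  have "(\<lambda>n. exp ((s - 1/2) * of_real x) * complex_of_real (exp (x / 2) *
      (2 * pi\<^sup>2 * exp (4 * x) * real (Suc n) ^ 4 - 3 * pi * exp (2 * x) * real (Suc n) ^ 2)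
      * exp (- (pi * exp (2 * x) * real (Suc n) ^ 2)))) sums (exp ((s - 1/2) * of_real x) * of_real (polya_kernel x))"
    by (intro sums_mult sums_of_real polya_kernel_sums)
  moreover have "exp ((s - 1/2) * of_real x) * complex_of_real (exp (x / 2) *
      (2 * pi\<^sup>2 * exp (4 * x) * r ^ 4 - 3 * pi * exp (2 * x) * r ^ 2)
      * exp (- (pi * exp (2 * x) * r ^ 2)))
     = 2 * of_real (pi\<^sup>2 * r ^ 4) * exp (2 * (s / 2 + 2) * of_real x - of_real (pi * r ^ 2 * exp (2 * x)))
      - 3 * of_real (pi * r ^ 2) * exp (2 * (s / 2 + 1) * of_real x - of_real (pi * r ^ 2 * exp (2 * x)))" for r :: real
  proof -
    define Q where "Q = exp (- complex_of_real (pi * r ^ 2 * exp (2 * x)))"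
    have "2 * (s / 2 + 2) * of_real x = (s - 1/2) * of_real x + of_real (x / 2) + of_real (4 * x)"
      by (simp add: field_simps)
    hence e4: "exp (2 * (s / 2 + 2) * of_real x) = exp ((s - 1/2) * of_real x) * of_real (exp (x / 2)) * of_real (exp (4 * x))"
      by (simp only: exp_add exp_of_real)
    have "2 * (s / 2 + 1) * of_real x = (s - 1/2) * of_real x + of_real (x / 2) + of_real (2 * x)"
      by (simp add: field_simps)
    hence e2: "exp (2 * (s / 2 + 1) * of_real x) = exp ((s - 1/2) * of_real x) * of_real (exp (x / 2)) * of_real (exp (2 * x))"
      by (simp only: exp_add exp_of_real)
    have q: "exp (y - of_real (pi * r ^ 2 * exp (2 * x))) = exp y * Q" for y
      by (simp add: Q_def exp_diff exp_minus divide_inverse)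
    have q': "complex_of_real (exp (- (pi * exp (2 * x) * r ^ 2))) = Q"
      by (simp add: Q_def mult_ac flip: exp_of_real)
    show ?thesis
      unfolding q e4 e2 unfolding of_real_mult of_real_diff q' by (simp add: algebra_simps)
  qed
  ultimately show ?thesis unfolding kernel_term_def by (simp only:)
qed

text \<open>The two parts give \<open>(s/2 + 1) \<Gamma>(s/2 + 1) - 3/2 \<Gamma>(s/2 + 1)\<close>, up to the common factor
\<open>(\<pi> n\<^sup>2)\<^sup>-\<^sup>s\<^sup>/\<^sup>2\<close>; this is where the factor \<open>s - 1\<close> that cancels the pole of zeta comes from.\<close>
lemma integral_kernel_term:
  assumes s: "Re s > 0" and n: "n > 0"
  shows "has_bochner_integral lborel (kernel_term s n)
    ((s - 1) / 2 * Gamma (s / 2 + 1) * of_real pi powr (- s / 2) * of_nat n powr (- s))"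
proof -
  define a where "a = pi * real n ^ 2"
  have a: "a > 0" using n by (simp add: a_def)
  have G: "Gamma (s / 2 + 2) = (s / 2 + 1) * Gamma (s / 2 + 1)"
  proof -
    have "s / 2 + 1 \<notin> \<int>\<^sub>\<le>\<^sub>0" using s by (auto elim!: nonpos_Ints_cases simp: complex_eq_iff)
    from Gamma_plus1[OF this] show ?thesis by (simp add: add.assoc)
  qed
  have pw: "complex_of_real a powr (s / 2 + 2) = complex_of_real a powr (s / 2) * of_real a ^ 2"
           "complex_of_real a powr (s / 2 + 1) = complex_of_real a powr (s / 2) * of_real a"
    using a powr_nat[of "complex_of_real a" 2] by (simp_all add: powr_add)
  have a_sq: "complex_of_real (pi\<^sup>2 * real n ^ 4) = of_real a ^ 2"
    by (simp add: a_def power_mult_distrib)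
  have "has_bochner_integral lborel (kernel_term s n)
    (2 * of_real a ^ 2 * (Gamma (s / 2 + 2) / (2 * of_real a powr (s / 2 + 2)))
     - 3 * of_real a * (Gamma (s / 2 + 1) / (2 * of_real a powr (s / 2 + 1))))"
    unfolding kernel_term_def[abs_def] a_sq unfolding a_def[symmetric]
    by (intro has_bochner_integral_diff has_bochner_integral_mult_right Mellin_transform_exp) (use s a in auto)
  also have "2 * of_real a ^ 2 * (Gamma (s / 2 + 2) / (2 * of_real a powr (s / 2 + 2)))
     - 3 * of_real a * (Gamma (s / 2 + 1) / (2 * of_real a powr (s / 2 + 1)))
    = (s - 1) / 2 * Gamma (s / 2 + 1) / of_real a powr (s / 2)"
  proof -
    have nz: "complex_of_real a \<noteq> 0" using a by simp
    have "2 * of_real a ^ 2 * (Gamma (s / 2 + 2) / (2 * of_real a powr (s / 2 + 2))) = Gamma (s / 2 + 2) / of_real a powr (s / 2)"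
      unfolding pw using nz by simp
    moreover have "3 * of_real a * (Gamma (s / 2 + 1) / (2 * of_real a powr (s / 2 + 1))) = 3 / 2 * Gamma (s / 2 + 1) / of_real a powr (s / 2)"
      unfolding pw using nz by simp
    moreover have "(s / 2 + 1) * X / P - 3 / 2 * X / P = (s - 1) / 2 * X / P" for X P :: complex
    proof -
      have "(s / 2 + 1) * X - 3 / 2 * X = (s - 1) / 2 * X" by (simp add: field_simps)
      thus ?thesis by (simp only: diff_divide_distrib[symmetric])
    qed
    ultimately show ?thesis unfolding G by (simp only:)
  qed
  also have "\<dots> = (s - 1) / 2 * Gamma (s / 2 + 1) * of_real pi powr (- s / 2) * of_nat n powr (- s)"
    unfolding a_def of_nat_powr_scale[OF n] minus_divide_left[symmetric] powr_minus
    by (simp only: divide_inverse inverse_mult_distrib mult.assoc)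
  finally show ?thesis .
qed

text \<open>The absolute value of either part is the same integrand with \<open>Re s\<close> in place of \<open>s\<close>, so the computation of
the integral applies to a sum instead of a difference.\<close>
lemma integral_norm_kernel_term_le:
  assumes s: "Re s > 0"
  shows "\<exists>C. \<forall>n>0. (\<integral>x. norm (kernel_term s n x) \<partial>lborel) \<le> C * real n powr (- Re s)"
proof -
  define \<sigma> where "\<sigma> = complex_of_real (Re s)"
  define C where "C = norm ((Gamma (\<sigma> / 2 + 2) + 3 / 2 * Gamma (\<sigma> / 2 + 1)) / of_real pi powr (\<sigma> / 2))"
  have "(\<integral>x. norm (kernel_term s n x) \<partial>lborel) \<le> C * real n powr (- Re s)" if n: "n > 0" for n
  proof -
    define a where "a = pi * real n ^ 2"
    have a: "a > 0" using n by (simp add: a_def)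
    have \<sigma>: "Re \<sigma> > 0" using s by (simp add: \<sigma>_def)
    let ?E = "\<lambda>w x. exp (2 * w * of_real x - of_real (a * exp (2 * x)))"
    define B where "B x = 2 * of_real a ^ 2 * ?E (\<sigma> / 2 + 2) x + 3 * of_real a * ?E (\<sigma> / 2 + 1) x" for x
    have a_sq: "complex_of_real (pi\<^sup>2 * real n ^ 4) = of_real a ^ 2"
      by (simp add: a_def power_mult_distrib)
    have pw: "complex_of_real a powr (\<sigma> / 2 + 2) = complex_of_real a powr (\<sigma> / 2) * of_real a ^ 2"
             "complex_of_real a powr (\<sigma> / 2 + 1) = complex_of_real a powr (\<sigma> / 2) * of_real a"
      using a powr_nat[of "complex_of_real a" 2] by (simp_all add: powr_add)
    have B: "has_bochner_integral lborel B
       (2 * of_real a ^ 2 * (Gamma (\<sigma> / 2 + 2) / (2 * of_real a powr (\<sigma> / 2 + 2)))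
       + 3 * of_real a * (Gamma (\<sigma> / 2 + 1) / (2 * of_real a powr (\<sigma> / 2 + 1))))"
      unfolding B_def[abs_def]
      by (intro has_bochner_integral_add has_bochner_integral_mult_right Mellin_transform_exp) (use \<sigma> a in auto)
    have B_val: "2 * of_real a ^ 2 * (Gamma (\<sigma> / 2 + 2) / (2 * of_real a powr (\<sigma> / 2 + 2)))
       + 3 * of_real a * (Gamma (\<sigma> / 2 + 1) / (2 * of_real a powr (\<sigma> / 2 + 1)))
       = (Gamma (\<sigma> / 2 + 2) + 3 / 2 * Gamma (\<sigma> / 2 + 1)) / of_real a powr (\<sigma> / 2)"
      using a unfolding pw by (simp add: add_divide_distrib)
    have norm_E: "norm (?E (s / 2 + k) x) = Re (?E (\<sigma> / 2 + k) x)" if "k \<in> \<real>" for k x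
    proof -
      have "?E (\<sigma> / 2 + k) x = of_real (exp (2 * (Re s / 2 + Re k) * x - a * exp (2 * x)))"
        using that by (elim Reals_cases) (simp add: \<sigma>_def flip: exp_of_real)
      moreover have "norm (?E (s / 2 + k) x) = exp (2 * (Re s / 2 + Re k) * x - a * exp (2 * x))"
        by (simp add: norm_exp_eq_Re)
      ultimately show ?thesis by simp
    qed
    have bound: "norm (kernel_term s n x) \<le> Re (B x)" for x
    proof -
      have "norm (kernel_term s n x) \<le> norm (2 * of_real a ^ 2 * ?E (s / 2 + 2) x) + norm (3 * of_real a * ?E (s / 2 + 1) x)"
        unfolding kernel_term_def a_sq unfolding a_def[symmetric] by (rule norm_triangle_ineq4)
      also have "\<dots> = 2 * a ^ 2 * Re (?E (\<sigma> / 2 + 2) x) + 3 * a * Re (?E (\<sigma> / 2 + 1) x)"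
        unfolding norm_mult using norm_E[of 2 x] norm_E[of 1 x] a by (simp add: norm_power)
      also have "\<dots> = Re (B x)" 
        by (simp add: B_def flip: of_real_power)
      finally show ?thesis .
  qed
  have "(\<integral>x. norm (kernel_term s n x) \<partial>lborel) \<le> (\<integral>x. Re (B x) \<partial>lborel)"
  proof (rule integral_mono)
    show "integrable lborel (\<lambda>x. norm (kernel_term s n x))"
      using integral_kernel_term[OF s n] by (auto simp: has_bochner_integral_iff)
    show "integrable lborel (\<lambda>x. Re (B x))" using B by (auto simp: has_bochner_integral_iff)
  qed (rule bound)
  also have "\<dots> = Re (integral\<^sup>L lborel B)" using B by (simp add: has_bochner_integral_iff)
  also have "\<dots> \<le> norm (integral\<^sup>L lborel B)" by (rule complex_Re_le_cmod)
  also have "integral\<^sup>L lborel B = (Gamma (\<sigma> / 2 + 2) + 3 / 2 * Gamma (\<sigma> / 2 + 1)) / of_real a powr (\<sigma> / 2)"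
    using B B_val by (simp add: has_bochner_integral_iff)
  also have "\<dots> = (Gamma (\<sigma> / 2 + 2) + 3 / 2 * Gamma (\<sigma> / 2 + 1)) / of_real pi powr (\<sigma> / 2) * of_nat n powr (- \<sigma>)"
    unfolding a_def of_nat_powr_scale[OF n] minus_divide_left[symmetric] powr_minus
    by (simp only: divide_inverse inverse_mult_distrib mult.assoc)
  also have "norm \<dots> = C * real n powr (- Re s)"
    unfolding norm_mult C_def using norm_powr_real_powr[of "of_nat n" "- \<sigma>"] n by (simp add: \<sigma>_def)
  finally show ?thesis .
  qed
  thus ?thesis by blast
qed

lemma summable_norm_kernel_term: "summable (\<lambda>n. norm (kernel_term s (Suc n) x))"
proof (rule summable_comparison_test)
  let ?e = "\<lambda>j n. real (Suc n) ^ (2 * j) * exp (- (pi * exp (2 * x) * real (Suc n) ^ 2))"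
  let ?c = "\<lambda>k. exp (2 * (Re s / 2 + k) * x)"
  show "summable (\<lambda>n. 2 * pi\<^sup>2 * ?c 2 * ?e 2 n + 3 * pi * ?c 1 * ?e 1 n)"
    by (intro summable_add summable_mult summable_moment_exp_square) simp_all
  show "\<exists>N. \<forall>n\<ge>N. norm (norm (kernel_term s (Suc n) x)) \<le> 2 * pi\<^sup>2 * ?c 2 * ?e 2 n + 3 * pi * ?c 1 * ?e 1 n"
  proof (intro exI allI impI)
    fix n :: nat
    have "norm (kernel_term s (Suc n) x) \<le>
        norm (2 * of_real (pi\<^sup>2 * real (Suc n) ^ 4) * exp (2 * (s / 2 + 2) * of_real x - of_real (pi * real (Suc n) ^ 2 * exp (2 * x))))
      + norm (3 * of_real (pi * real (Suc n) ^ 2) * exp (2 * (s / 2 + 1) * of_real x - of_real (pi * real (Suc n) ^ 2 * exp (2 * x))))"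
      unfolding kernel_term_def by (rule norm_triangle_ineq4)
    also have "\<dots> = 2 * pi\<^sup>2 * ?c 2 * ?e 2 n + 3 * pi * ?c 1 * ?e 1 n"
    proof -
      have exp_diff': "exp (a - b) = exp a * exp (- b)" for a b :: real
        using exp_add[of a "- b"] by simp
      have "Re (2 * (s / 2 + k) * of_real x - of_real (pi * real (Suc n) ^ 2 * exp (2 * x)))
          = 2 * (Re s / 2 + Re k) * x - pi * exp (2 * x) * real (Suc n) ^ 2" if "k \<in> \<real>" for k
        using that by (elim Reals_cases) (simp add: mult_ac del: of_nat_Suc)
      from this[of 2] this[of 1] show ?thesis
        unfolding norm_mult norm_exp_eq_Re norm_of_real
        by (simp add: exp_diff' mult_ac abs_mult del: of_nat_Suc)
    qed
    finally show "norm (norm (kernel_term s (Suc n) x)) \<le> 2 * pi\<^sup>2 * ?c 2 * ?e 2 n + 3 * pi * ?c 1 * ?e 1 n"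
      by simp
  qed
qed

text \<open>The \<open>L\<^sup>1\<close> norms of the terms are \<open>O(n powr - Re s)\<close>, so sum and integral may be interchanged for \<open>Re s > 1\<close>.\<close>
theorem kernel_transform_Dirichlet_series:
  assumes s: "Re s > 1"
  shows "(\<lambda>n. (s - 1) / 2 * Gamma (s / 2 + 1) * of_real pi powr (- s / 2) * of_nat (Suc n) powr (- s))
           sums kernel_transform (s - 1/2)"
proof -
  have s0: "Re s > 0" using s by simp
  obtain C where C: "\<And>n. n > 0 \<Longrightarrow> (\<integral>x. norm (kernel_term s n x) \<partial>lborel) \<le> C * real n powr (- Re s)"
    using integral_norm_kernel_term_le[OF s0] by blast
  have "summable (\<lambda>n. \<integral>x. norm (kernel_term s (Suc n) x) \<partial>lborel)"
  proof (rule summable_comparison_test)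
    have "summable (\<lambda>n. real n powr (- Re s))" using s by (simp add: summable_real_powr_iff)
    hence "summable (\<lambda>n. C * real (Suc n) powr (- Re s))" by (intro summable_mult) (subst summable_Suc_iff[of "\<lambda>n. real n powr (- Re s)"])
    thus "summable (\<lambda>n. C * real (Suc n) powr (- Re s))" .
    show "\<exists>N. \<forall>n\<ge>N. norm (\<integral>x. norm (kernel_term s (Suc n) x) \<partial>lborel) \<le> C * real (Suc n) powr (- Re s)"
      using C[of "Suc n" for n] by (intro exI allI impI) (simp add: integral_nonneg_AE del: of_nat_Suc)
  qed
  hence "(\<lambda>n. integral\<^sup>L lborel (kernel_term s (Suc n))) sums (\<integral>x. (\<Sum>n. kernel_term s (Suc n) x) \<partial>lborel)"
    using integral_kernel_term[OF s0] summable_norm_kernel_term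
    by (intro sums_integral) (auto simp: has_bochner_integral_iff)
  also have "(\<lambda>x. \<Sum>n. kernel_term s (Suc n) x) = (\<lambda>x. exp ((s - 1/2) * of_real x) * of_real (polya_kernel x))"
    using sums_unique[OF kernel_term_sums[of s]] by auto
  also have "(\<integral>x. exp ((s - 1/2) * of_real x) * of_real (polya_kernel x) \<partial>lborel) = kernel_transform (s - 1/2)"
    by (simp add: kernel_transform_def)
  finally have sums: "(\<lambda>n. integral\<^sup>L lborel (kernel_term s (Suc n))) sums kernel_transform (s - 1/2)" .
  have "integral\<^sup>L lborel (kernel_term s (Suc n))
      = (s - 1) / 2 * Gamma (s / 2 + 1) * of_real pi powr (- s / 2) * of_nat (Suc n) powr (- s)" for n
    using integral_kernel_term[OF s0, of "Suc n"] by (simp only: has_bochner_integral_iff zero_less_Suc simp_thms)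
  with sums show ?thesis by (simp only:)
qed

text \<open>The identity of \<open>kernel_transform_Dirichlet_series\<close> solved for the Dirichlet series. Shifting the
Gamma factor to \<open>s/2 + 1\<close> keeps the point \<open>s = 0\<close> regular.\<close>
definition zeta_continuation :: "complex \<Rightarrow> complex" where
  "zeta_continuation s =
     (if s = 1 then 0
      else 2 * kernel_transform (s - 1/2) * of_real pi powr (s / 2) * rGamma (s / 2 + 1) / (s - 1))"

lemma holomorphic_zeta_continuation: "zeta_continuation holomorphic_on (- {1})"
proof -
  have "(\<lambda>s. 2 * kernel_transform (s - 1/2) * of_real pi powr (s / 2) * rGamma (s / 2 + 1) / (s - 1)) holomorphic_on (- {1})"
    by (intro holomorphic_intros holomorphic_on_compose_gen[OF _ holomorphic_kernel_transform, unfolded o_def]) auto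
  thus ?thesis
    by (rule holomorphic_transform) (auto simp: zeta_continuation_def)
qed

lemma zeta_continuation_sums:
  assumes s: "Re s > 1"
  shows "(\<lambda>n. 1 / of_nat (Suc n) powr s) sums zeta_continuation s"
proof -
  let ?c = "(s - 1) / 2 * Gamma (s / 2 + 1) * of_real pi powr (- s / 2)"
  have s1: "s \<noteq> 1" using s by auto
  have "s / 2 + 1 \<notin> \<int>\<^sub>\<le>\<^sub>0" using s by (auto elim!: nonpos_Ints_cases simp: complex_eq_iff)
  hence G: "Gamma (s / 2 + 1) * rGamma (s / 2 + 1) = 1"
    by (simp add: Gamma_def rGamma_eq_zero_iff)
  have P: "complex_of_real pi powr (- s / 2) * of_real pi powr (s / 2) = 1"
    by (simp add: powr_minus)
  have "(2 * of_real pi powr (s / 2) * rGamma (s / 2 + 1) / (s - 1)) * ?c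
      = (Gamma (s / 2 + 1) * rGamma (s / 2 + 1)) * (complex_of_real pi powr (- s / 2) * of_real pi powr (s / 2))"
    using s1 by (simp add: field_simps)
  hence c: "(2 * of_real pi powr (s / 2) * rGamma (s / 2 + 1) / (s - 1)) * ?c = 1" unfolding G P by simp
  have "(\<lambda>n. (2 * of_real pi powr (s / 2) * rGamma (s / 2 + 1) / (s - 1)) * (?c * of_nat (Suc n) powr (- s)))
     sums ((2 * of_real pi powr (s / 2) * rGamma (s / 2 + 1) / (s - 1)) * kernel_transform (s - 1/2))"
    by (intro sums_mult kernel_transform_Dirichlet_series s)
  thus ?thesis
    unfolding mult.assoc[symmetric, of _ ?c] c using s1
    by (simp add: zeta_continuation_def powr_minus inverse_eq_divide mult_ac del: of_nat_Suc)
qed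

lemma riemann_zeta_eq: "riemann_zeta = zeta_continuation"
  unfolding riemann_zeta_def
proof (rule the_equality)
  show "zeta_continuation holomorphic_on - {1} \<and> zeta_continuation 1 = 0 \<and>
    (\<forall>s. 1 < Re s \<longrightarrow> (\<lambda>n. 1 / of_nat (Suc n) powr s) sums zeta_continuation s)"
    using holomorphic_zeta_continuation zeta_continuation_sums by (auto simp: zeta_continuation_def)
next
  fix f assume f: "f holomorphic_on - {1} \<and> f 1 = 0 \<and>
    (\<forall>s. 1 < Re s \<longrightarrow> (\<lambda>n. 1 / of_nat (Suc n) powr s) sums f s)"
  show "f = zeta_continuation"
  proof
    fix s
    show "f s = zeta_continuation s"
    proof (cases "s = 1")
      case False
      show ?thesis
      proof (rule analytic_continuation_open[where s = "{s. Re s > 1}" and s' = "- {1}" and f = f and g = zeta_continuation])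
        show "open {s. Re s > 1}" by (rule open_halfspace_Re_gt)
        show "{s. Re s > 1} \<noteq> {}" by (auto intro: exI[of _ 2])
        show "connected (- {1 :: complex})" by (intro connected_punctured_universe) simp
        show "f z = zeta_continuation z" if "z \<in> {s. Re s > 1}" for z
          using that f zeta_continuation_sums[of z] sums_unique2 by blast
      qed (use f holomorphic_zeta_continuation False in auto)
    qed (use f in \<open>simp add: zeta_continuation_def\<close>)
  qed
qed

text \<open>On the critical line the product that defines \<open>\<xi>\<close> is analytic, so removing singularities keeps its value, and
the factors introduced by \<open>zeta_continuation\<close> cancel.\<close>
theorem riemann_Xi_eq_kernel_transform:
  "riemann_Xi (of_real \<alpha>) = 2 * kernel_transform (\<i> * of_real \<alpha>)"
proof -
  define s where "s = 1/2 + \<i> * complex_of_real \<alpha>"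
  define f where "f = (\<lambda>s. 1/2 * s * (s - 1) * of_real pi powr (- s / 2) * Gamma (s / 2) * riemann_zeta s)"
  let ?A = "{s. Re s > 0} - {1}"
  have Re_s: "Re s = 1/2" by (simp add: s_def)
  have nonpos: "z / 2 \<notin> \<int>\<^sub>\<le>\<^sub>0" if "Re z > 0" for z :: complex
    using that by (auto elim!: nonpos_Ints_cases simp: complex_eq_iff)
  have "f holomorphic_on ?A"
    unfolding f_def riemann_zeta_eq
    by (intro holomorphic_intros holomorphic_on_subset[OF holomorphic_zeta_continuation]) (use nonpos in auto)
  moreover have "open ?A" by (intro open_Diff open_halfspace_Re_gt) auto
  moreover have sA: "s \<in> ?A" using Re_s by auto
  ultimately have "f analytic_on {s}" by (meson analytic_at)
  hence "riemann_Xi (of_real \<alpha>) = f s"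
    unfolding riemann_Xi_def riemann_xi_def f_def[symmetric] s_def[symmetric] by simp
  also have "f s = 2 * kernel_transform (s - 1/2) *
      (of_real pi powr (- s / 2) * of_real pi powr (s / 2)) * (s / 2 * Gamma (s / 2) * rGamma (s / 2 + 1))"
  proof -
    have "(1/2 * s * d * P * G) * (2 * K * Q * R / d) = 2 * K * (P * Q) * (s / 2 * G * R)"
      if "d \<noteq> 0" for d P G K Q R :: complex
      using that by (simp add: field_simps)
    thus ?thesis using sA by (simp add: f_def riemann_zeta_eq zeta_continuation_def)
  qed
  also have "of_real pi powr (- s / 2) * complex_of_real pi powr (s / 2) = 1" by (simp add: powr_minus)
  also have "s / 2 * Gamma (s / 2) * rGamma (s / 2 + 1) = Gamma (s / 2) * rGamma (s / 2)"
    using rGamma_plus1[of "s / 2"] by (simp add: mult_ac)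
  also have "\<dots> = 1" using nonpos[of s] Re_s by (simp add: Gamma_def rGamma_eq_zero_iff)
  finally show ?thesis by (simp add: s_def)
qed

section \<open>Antiderivatives over the line\<close>

lemma integral_atMost_has_vector_derivative:
  fixes h :: "real \<Rightarrow> complex"
  assumes int: "integrable lborel h" and cont: "continuous_on UNIV h"
  shows "((\<lambda>x. LINT y:{..x}|lborel. h y) has_vector_derivative h x) (at x)"
proof -
  have set_int: "set_integrable lborel A h" if "A \<in> sets borel" for A
    unfolding set_integrable_def using that by (intro integrable_mult_indicator int) simp
  define a where "a = x - 1"
  have split: "(LINT y:{..u}|lborel. h y) = (LINT y:{..<a}|lborel. h y) + integral {a..u} h" if "u \<ge> a" for u
  proof -
    have "{..u} = {..<a} \<union> {a..u}" using that by auto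
    hence "(LINT y:{..u}|lborel. h y) = (LINT y:{..<a}|lborel. h y) + (LINT y:{a..u}|lborel. h y)"
      by (simp only:) (intro set_integral_Un set_int, auto)
    thus ?thesis by (simp add: set_borel_integral_eq_integral(2)[OF set_int])
  qed
  have "((\<lambda>u. integral {a..u} h) has_vector_derivative h x) (at x within {a..x + 1})"
    by (rule integral_has_vector_derivative) (auto simp: a_def intro: continuous_on_subset[OF cont])
  hence "((\<lambda>u. integral {a..u} h) has_vector_derivative h x) (at x)"
    by (subst (asm) at_within_interior) (auto simp: a_def interior_atLeastAtMost_real)
  hence "((\<lambda>u. (LINT y:{..<a}|lborel. h y) + integral {a..u} h) has_vector_derivative 0 + h x) (at x)"
    by (intro has_vector_derivative_add has_vector_derivative_const)
  hence "((\<lambda>u. (LINT y:{..<a}|lborel. h y) + integral {a..u} h) has_vector_derivative h x) (at x)" by simp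
  thus ?thesis
    by (rule has_vector_derivative_transform_within_open[of _ _ _ "{a<..}"]) (auto simp: a_def split)
qed

lemma integral_atMost_tendsto:
  fixes h :: "real \<Rightarrow> complex"
  assumes int: "integrable lborel h"
  shows "((\<lambda>x. LINT y:{..x}|lborel. h y) \<longlongrightarrow> integral\<^sup>L lborel h) at_top"
    and "((\<lambda>x. LINT y:{..x}|lborel. h y) \<longlongrightarrow> 0) at_bot"
proof -
  have meas: "h \<in> borel_measurable lborel" using int by auto
  have "((\<lambda>x. \<integral>y. indicator {..x} y *\<^sub>R h y \<partial>lborel) \<longlongrightarrow> integral\<^sup>L lborel h) at_top"
  proof (rule integral_dominated_convergence_at_top[where w = "\<lambda>y. norm (h y)"])
    have "eventually (\<lambda>x. indicator {..x} y *\<^sub>R h y = h y) at_top" for y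
      using eventually_ge_at_top[of y] by eventually_elim simp
    thus "AE y in lborel. ((\<lambda>x. indicator {..x} y *\<^sub>R h y) \<longlongrightarrow> h y) at_top"
      by (intro AE_I2 tendsto_eventually)
    show "\<forall>\<^sub>F x in at_top. AE y in lborel. norm (indicator {..x} y *\<^sub>R h y) \<le> norm (h y)"
      by (intro always_eventually allI AE_I2) (simp add: indicator_def)
  qed (use meas int in auto)
  thus "((\<lambda>x. LINT y:{..x}|lborel. h y) \<longlongrightarrow> integral\<^sup>L lborel h) at_top"
    by (simp add: set_lebesgue_integral_def)
  have "((\<lambda>x. \<integral>y. indicator {..- x} y *\<^sub>R h y \<partial>lborel) \<longlongrightarrow> (\<integral>y. 0 \<partial>(lborel :: real measure))) at_top"
  proof (rule integral_dominated_convergence_at_top[where w = "\<lambda>y. norm (h y)"])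
    have "eventually (\<lambda>x. indicator {..- x} y *\<^sub>R h y = 0) at_top" for y
      using eventually_gt_at_top[of "- y"] by eventually_elim simp
    thus "AE y in lborel. ((\<lambda>x. indicator {..- x} y *\<^sub>R h y) \<longlongrightarrow> 0) at_top"
      by (intro AE_I2 tendsto_eventually)
    show "\<forall>\<^sub>F x in at_top. AE y in lborel. norm (indicator {..- x} y *\<^sub>R h y) \<le> norm (h y)"
      by (intro always_eventually allI AE_I2) (simp add: indicator_def)
  qed (use meas int in auto)
  thus "((\<lambda>x. LINT y:{..x}|lborel. h y) \<longlongrightarrow> 0) at_bot"
    by (simp add: set_lebesgue_integral_def filterlim_at_bot_mirror)
qed

section \<open>The boundary value problem\<close>

definition Theta_line :: "real \<Rightarrow> real" where
  "Theta_line t = polya_kernel (ln t)"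

lemma Theta00_line:
  assumes "t > 0"
  shows "Theta00 (\<i> * of_real (t\<^sup>2)) = of_real (Theta_line t)"
  using Theta00_exp[of "ln t"] assms by (simp add: Theta_line_def)

lemma Theta_line_pos: "Theta_line t > 0"
  by (simp add: Theta_line_def polya_kernel_pos)

lemma Theta_line_differentiable:
  assumes t: "t > 0"
  obtains D where "(Theta_line has_real_derivative D) (at t)"
proof -
  have "\<exists>D. (polya_kernel has_real_derivative D) (at x)" for x
    unfolding polya_kernel_def[abs_def]
    by (rule exI) (auto intro!: derivative_eq_intros DERIV_chain2[OF has_real_derivative_real_theta_moment])
  then obtain D where D: "(polya_kernel has_real_derivative D) (at (ln t))" by blast
  have "((\<lambda>t. polya_kernel (ln t)) has_real_derivative D * (1 / t)) (at t)"
    by (rule DERIV_chain2[where f = polya_kernel and g = ln, OF D]) (use t in \<open>auto intro!: derivative_eq_intros simp: field_simps\<close>)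
  thus ?thesis using that unfolding Theta_line_def[abs_def] by blast
qed

text \<open>\<open>t\<^sup>i\<^sup>\<alpha>\<close> for \<open>t > 0\<close>, a point of the unit circle.\<close>
definition rot :: "real \<Rightarrow> real \<Rightarrow> complex" where
  "rot \<alpha> t = exp (\<i> * of_real (\<alpha> * ln t))"

lemma rot_eq_powr:
  assumes "t > 0"
  shows "of_real t powr (\<i> * of_real \<alpha>) = rot \<alpha> t"
    and "of_real t powr (- \<i> * of_real \<alpha>) = rot (- \<alpha>) t"
  using assms by (simp_all add: powr_def rot_def Ln_of_real mult_ac)

lemma norm_rot [simp]: "norm (rot \<alpha> t) = 1"
  unfolding rot_def by (rule norm_exp_i_times)

lemma rot_mult_minus [simp]: "rot (- \<alpha>) t * rot \<alpha> t = 1" "rot \<alpha> t * rot (- \<alpha>) t = 1"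
  by (simp_all add: rot_def flip: exp_add)

lemma rot_deriv:
  assumes "t > 0"
  shows "(rot \<alpha> has_vector_derivative \<i> * of_real \<alpha> * rot \<alpha> t / of_real t) (at t)"
proof -
  have "((\<lambda>t. \<i> * of_real (\<alpha> * ln t)) has_vector_derivative \<i> * of_real (\<alpha> * (1 / t))) (at t)"
    using assms by (auto intro!: derivative_eq_intros has_vector_derivative_of_real
        has_vector_derivative_mult_right simp: has_real_derivative_iff_has_vector_derivative[symmetric] field_simps)
  from field_vector_diff_chain_at[OF this DERIV_exp]
  show ?thesis by (simp add: rot_def[abs_def] o_def mult_ac)
qed

text \<open>The integral of \<open>y\<^sup>i\<^sup>\<alpha> \<Theta>(i y\<^sup>2) dy/y\<close> from \<open>0\<close> to \<open>t\<close>, in the variable \<open>x = log y\<close>.\<close>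
definition primitive :: "real \<Rightarrow> real \<Rightarrow> complex" where
  "primitive \<alpha> t = (LINT x:{..ln t}|lborel. exp (\<i> * of_real \<alpha> * of_real x) * of_real (polya_kernel x))"

lemma primitive_deriv:
  assumes t: "t > 0"
  shows "(primitive \<alpha> has_vector_derivative rot \<alpha> t * of_real (Theta_line t) / of_real t) (at t)"
proof -
  let ?h = "\<lambda>x. exp (\<i> * of_real \<alpha> * of_real x) * complex_of_real (polya_kernel x)"
  have 1: "((\<lambda>x. LINT y:{..x}|lborel. ?h y) has_vector_derivative ?h (ln t)) (at (ln t))"
    by (intro integral_atMost_has_vector_derivative integrable_kernel_transform
        continuous_intros continuous_polya_kernel)
  have "(ln has_vector_derivative 1 / t) (at t)"
    using t by (auto intro!: derivative_eq_intros simp: has_real_derivative_iff_has_vector_derivative[symmetric] field_simps)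
  from vector_diff_chain_at[OF this 1] show ?thesis
    by (simp add: o_def primitive_def[abs_def] rot_def Theta_line_def scaleR_conv_of_real mult_ac)
qed

lemma primitive_tendsto:
  "(primitive \<alpha> \<longlongrightarrow> 0) (at_right 0)"
  "(primitive \<alpha> \<longlongrightarrow> kernel_transform (\<i> * of_real \<alpha>)) at_top"
  unfolding primitive_def[abs_def] kernel_transform_def
  by (intro filterlim_compose[OF integral_atMost_tendsto(2)] filterlim_compose[OF integral_atMost_tendsto(1)]
      integrable_kernel_transform ln_at_0 ln_at_top)+

text \<open>By the fundamental theorem of calculus the integral from \<open>\<epsilon>\<close> to \<open>t\<close> is a difference of values of \<open>primitive\<close>,
which vanishes at \<open>0\<close>.\<close>
lemma u_sol_eq:
  assumes t: "t > 0"
  shows "u_sol \<alpha> t = rot (- \<alpha>) t * primitive \<alpha> t"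
proof -
  let ?f = "\<lambda>y. of_real y powr (\<i> * of_real \<alpha>) * Theta00 (\<i> * of_real (y\<^sup>2)) / of_real y"
  have "integral {\<epsilon>..t} ?f = primitive \<alpha> t - primitive \<alpha> \<epsilon>" if "0 < \<epsilon>" "\<epsilon> < t" for \<epsilon>
  proof (rule integral_unique, rule fundamental_theorem_of_calculus)
    fix y assume "y \<in> {\<epsilon>..t}"
    hence y: "y > 0" using that by simp
    have f_eq: "?f y = rot \<alpha> y * of_real (Theta_line y) / of_real y"
      by (simp only: rot_eq_powr(1)[OF y] Theta00_line[OF y])
    show "(primitive \<alpha> has_vector_derivative ?f y) (at y within {\<epsilon>..t})"
      unfolding f_eq by (rule has_vector_derivative_at_within[OF primitive_deriv[OF y]])
  qed (use that in simp)
  hence "eventually (\<lambda>\<epsilon>. primitive \<alpha> t - primitive \<alpha> \<epsilon> = integral {\<epsilon>..t} ?f) (at_right 0)"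
    using eventually_at_right_real[OF t] by (auto elim!: eventually_mono)
  moreover have "((\<lambda>\<epsilon>. primitive \<alpha> t - primitive \<alpha> \<epsilon>) \<longlongrightarrow> primitive \<alpha> t - 0) (at_right 0)"
    by (intro tendsto_intros primitive_tendsto)
  ultimately have "((\<lambda>\<epsilon>. integral {\<epsilon>..t} ?f) \<longlongrightarrow> primitive \<alpha> t) (at_right 0)"
    by (simp add: tendsto_cong)
  hence "Lim (at_right 0) (\<lambda>\<epsilon>. integral {\<epsilon>..t} ?f) = primitive \<alpha> t"
    by (intro tendsto_Lim) simp_all
  thus ?thesis unfolding u_sol_def using rot_eq_powr(2)[OF t, of \<alpha>] by simp
qed

lemma of_real_differentiable: "complex_of_real differentiable (at t)"
  by (rule differentiableI_vector[OF has_vector_derivative_of_real[OF DERIV_ident]])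

text \<open>With \<open>\<phi> = - log \<Phi>\<close> the operator is \<open>L v = \<Phi> D (v / \<Phi>)\<close>, so its kernel consists of the multiples of \<open>\<Phi>\<close>.\<close>
lemma L_op_quotient_deriv:
  assumes t: "t > 0" and v: "(v has_vector_derivative v') (at t)"
  shows "((\<lambda>s. v s / of_real (Theta_line s)) has_vector_derivative
            \<i> * L_op phi00 v t / of_real (t * Theta_line t)) (at t)"
proof -
  obtain D where D: "(Theta_line has_real_derivative D) (at t)"
    using Theta_line_differentiable[OF t] .
  let ?P = "Theta_line t"
  have P: "?P > 0" by (rule Theta_line_pos)
  have "((\<lambda>s. - ln (Theta_line s)) has_real_derivative - (D / ?P)) (at t)"
    using P by (auto intro!: derivative_eq_intros D simp: field_simps)
  hence "((\<lambda>s. complex_of_real (- ln (Theta_line s))) has_vector_derivative of_real (- (D / ?P))) (at t)"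
    by (rule has_vector_derivative_of_real)
  hence "(phi00 has_vector_derivative of_real (- (D / ?P))) (at t)"
  proof (rule has_vector_derivative_transform_within_open[of _ _ _ "{0<..}"])
    fix s :: real assume "s \<in> {0<..}"
    thus "complex_of_real (- ln (Theta_line s)) = phi00 s"
      unfolding phi00_def using Theta00_line[of s] Theta_line_pos[of s] by (simp add: Ln_of_real)
  qed (use t in auto)
  hence phi: "vector_derivative phi00 (at t) = - (of_real D / of_real ?P)"
    by (simp add: vector_derivative_at)
  have L: "L_op phi00 v t = of_real t / \<i> * (v' - v t * of_real D / of_real ?P)"
    unfolding L_op_def D_times_def phi vector_derivative_at[OF v] by (simp add: algebra_simps)
  have "((\<lambda>s. inverse (Theta_line s)) has_real_derivative - (D / ?P\<^sup>2)) (at t)"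
    using P by (auto intro!: derivative_eq_intros D simp: field_simps power2_eq_square)
  hence "((\<lambda>s. complex_of_real (inverse (Theta_line s))) has_vector_derivative of_real (- (D / ?P\<^sup>2))) (at t)"
    by (rule has_vector_derivative_of_real)
  from has_vector_derivative_mult[OF v this]
  have "((\<lambda>s. v s * complex_of_real (inverse (Theta_line s))) has_vector_derivative
     v t * of_real (- (D / ?P\<^sup>2)) + v' * of_real (inverse ?P)) (at t)" .
  moreover have "v t * of_real (- (D / ?P\<^sup>2)) + v' * of_real (inverse ?P)
     = \<i> * L_op phi00 v t / of_real (t * Theta_line t)"
    unfolding L using P t by (simp add: field_simps power2_eq_square)
  ultimately show ?thesis by (simp add: divide_inverse)
qed

lemma L_op_linear:
  assumes "v differentiable (at t)" "w differentiable (at t)"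
  shows "L_op \<phi> v t + a * L_op \<phi> w t = L_op \<phi> (\<lambda>s. v s + a * w s) t"
proof -
  have "((\<lambda>s. v s + a * w s) has_vector_derivative vector_derivative v (at t) + a * vector_derivative w (at t)) (at t)"
    using assms by (intro has_vector_derivative_add has_vector_derivative_mult_right) (simp_all add: vector_derivative_works)
  hence "vector_derivative (\<lambda>s. v s + a * w s) (at t) = vector_derivative v (at t) + a * vector_derivative w (at t)"
    by (rule vector_derivative_at)
  thus ?thesis by (simp add: L_op_def D_times_def algebra_simps)
qed

text \<open>The equation makes \<open>D u + \<alpha> u\<close> a multiple \<open>c \<Phi>\<close>, whence \<open>t\<^sup>i\<^sup>\<alpha> u - i c J\<close> is constant, where \<open>J\<close> is
\<open>primitive\<close>. The limit at \<open>0\<close> shows that the constant is zero, and the limit at infinity that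
\<open>i c\<close> times the full integral vanishes.\<close>
lemma bvp_solution_imp:
  assumes "bvp_solution \<alpha> u"
  shows "\<exists>c. c * kernel_transform (\<i> * of_real \<alpha>) = 0 \<and> (\<forall>t>0. u t = c * (rot (- \<alpha>) t * primitive \<alpha> t))"
proof -
  let ?I = "kernel_transform (\<i> * of_real \<alpha>)"
  have du: "u differentiable (at t)" and ddu: "(\<lambda>s. vector_derivative u (at s)) differentiable (at t)"
    and eq: "L_op phi00 (D_times u) t + of_real \<alpha> * L_op phi00 u t = 0" if "t > 0" for t
    using assms that by (auto simp: bvp_solution_def)
  have u_0: "(u \<longlongrightarrow> 0) (at_right 0)" and u_inf: "(u \<longlongrightarrow> 0) at_top"
    using assms by (auto simp: bvp_solution_def)
  define v where "v s = D_times u s + of_real \<alpha> * u s" for s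
  have dDu: "D_times u differentiable (at t)" if "t > 0" for t
    unfolding D_times_def[abs_def]
    by (intro differentiable_mult differentiable_divide differentiable_const of_real_differentiable ddu that) simp
  have dv: "v differentiable (at t)" if "t > 0" for t
    unfolding v_def[abs_def] by (intro differentiable_add differentiable_mult dDu du that) simp
  have "L_op phi00 v t = 0" if "t > 0" for t
    using eq[OF that] L_op_linear[OF dDu[OF that] du[OF that]] by (simp add: v_def[abs_def])
  hence "((\<lambda>s. v s / of_real (Theta_line s)) has_vector_derivative 0) (at t within {0<..})" if "t \<in> {0<..}" for t
    using L_op_quotient_deriv[of t v "vector_derivative v (at t)"] dv[of t] that
    by (simp add: vector_derivative_works has_vector_derivative_at_within)
  then obtain c where quotient: "\<And>t. t > 0 \<Longrightarrow> v t / of_real (Theta_line t) = c"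
    using has_vector_derivative_zero_constant[of "{0<..} :: real set" "\<lambda>s. v s / of_real (Theta_line s)"] by auto
  hence v: "v t = c * of_real (Theta_line t)" if "t > 0" for t
    using quotient[OF that] Theta_line_pos[of t] by (simp add: divide_eq_eq)
  define W where "W t = rot \<alpha> t * u t - \<i> * c * primitive \<alpha> t" for t
  have "(W has_vector_derivative 0) (at t within {0<..})" if "t \<in> {0<..}" for t
  proof -
    have t: "t > 0" using that by simp
    let ?u' = "vector_derivative u (at t)"
    have "(W has_vector_derivative (rot \<alpha> t * ?u' + \<i> * of_real \<alpha> * rot \<alpha> t / of_real t * u t)
         - \<i> * c * (rot \<alpha> t * of_real (Theta_line t) / of_real t)) (at t)"
      unfolding W_def[abs_def]
      by (intro has_vector_derivative_diff has_vector_derivative_mult has_vector_derivative_mult_right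
          rot_deriv primitive_deriv t) (use du[OF t] in \<open>simp add: vector_derivative_works\<close>)
    moreover have "of_real t / \<i> * ?u' + of_real \<alpha> * u t = c * of_real (Theta_line t)"
      using v[OF t] by (simp add: v_def D_times_def)
    hence u': "?u' = \<i> / of_real t * (c * of_real (Theta_line t) - of_real \<alpha> * u t)"
      using t by (simp add: field_simps)
    have "(rot \<alpha> t * ?u' + \<i> * of_real \<alpha> * rot \<alpha> t / of_real t * u t)
         - \<i> * c * (rot \<alpha> t * of_real (Theta_line t) / of_real t) = 0"
      unfolding u' using t by (simp add: field_simps)
    ultimately show ?thesis by (simp add: has_vector_derivative_at_within)
  qed
  then obtain k where k: "\<And>t. t > 0 \<Longrightarrow> W t = k"
    using has_vector_derivative_zero_constant[of "{0<..} :: real set" W] by auto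
  have rot_lim: "((\<lambda>t. rot \<alpha> t * u t) \<longlongrightarrow> 0) F" if "(u \<longlongrightarrow> 0) F" for F
    by (rule tendsto_norm_zero_cancel) (use tendsto_norm_zero[OF that] in \<open>simp add: norm_mult\<close>)
  have "(W \<longlongrightarrow> 0 - \<i> * c * 0) (at_right 0)"
    unfolding W_def[abs_def] by (intro tendsto_intros rot_lim u_0 primitive_tendsto)
  moreover have "(W \<longlongrightarrow> k) (at_right 0)"
    using eventually_at_right_less[of 0] by (intro tendsto_eventually) (auto elim!: eventually_mono simp: k)
  ultimately have k0: "k = 0" using tendsto_unique[of "at_right (0 :: real)" W] by auto
  have "(W \<longlongrightarrow> 0 - \<i> * c * ?I) at_top"
    unfolding W_def[abs_def] by (intro tendsto_intros rot_lim u_inf primitive_tendsto)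
  moreover have "(W \<longlongrightarrow> k) at_top"
    by (intro tendsto_eventually eventually_mono[OF eventually_gt_at_top[of 0]] k)
  ultimately have "0 - \<i> * c * ?I = k" by (rule tendsto_unique[OF trivial_limit_at_top_linorder])
  hence "\<i> * c * ?I = 0" by (simp add: k0)
  moreover have "u t = (\<i> * c) * (rot (- \<alpha>) t * primitive \<alpha> t)" if "t > 0" for t
  proof -
    have "rot \<alpha> t * u t = \<i> * c * primitive \<alpha> t" using k[OF that] k0 by (simp add: W_def)
    hence "rot (- \<alpha>) t * (rot \<alpha> t * u t) = rot (- \<alpha>) t * (\<i> * c * primitive \<alpha> t)" by simp
    thus ?thesis unfolding mult.assoc[symmetric] rot_mult_minus by (simp add: mult_ac)
  qed
  ultimately show ?thesis by (intro exI[of _ "\<i> * c"]) auto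
qed

text \<open>The given \<open>u\<close> satisfies \<open>D u + \<alpha> u = (c / i) \<Phi>\<close>, which \<open>L\<close> annihilates. Since \<open>\<bar>u\<bar> = \<bar>c J\<bar>\<close>, the boundary
conditions are statements about the limits of \<open>c J\<close>.\<close>
lemma bvp_solution_if:
  assumes c: "c * kernel_transform (\<i> * of_real \<alpha>) = 0"
    and u: "\<And>t. t > 0 \<Longrightarrow> u t = c * (rot (- \<alpha>) t * primitive \<alpha> t)"
  shows "bvp_solution \<alpha> u"
proof -
  let ?u' = "\<lambda>t. (c * of_real (Theta_line t) - \<i> * of_real \<alpha> * u t) / of_real t"
  have u': "(u has_vector_derivative ?u' t) (at t)" if t: "t > 0" for t
  proof -
    have "((\<lambda>t. c * (rot (- \<alpha>) t * primitive \<alpha> t)) has_vector_derivative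
       c * (rot (- \<alpha>) t * (rot \<alpha> t * of_real (Theta_line t) / of_real t)
          + \<i> * of_real (- \<alpha>) * rot (- \<alpha>) t / of_real t * primitive \<alpha> t)) (at t)"
      by (intro has_vector_derivative_mult has_vector_derivative_mult_right rot_deriv primitive_deriv t)
    moreover have "rot (- \<alpha>) t * (rot \<alpha> t * of_real (Theta_line t) / of_real t) = of_real (Theta_line t) / of_real t"
      by (simp add: mult.assoc[symmetric])
    ultimately have "((\<lambda>t. c * (rot (- \<alpha>) t * primitive \<alpha> t)) has_vector_derivative
       c * (of_real (Theta_line t) / of_real t
          + \<i> * of_real (- \<alpha>) * rot (- \<alpha>) t / of_real t * primitive \<alpha> t)) (at t)" by (simp only:)
    also have "c * (of_real (Theta_line t) / of_real t
          + \<i> * of_real (- \<alpha>) * rot (- \<alpha>) t / of_real t * primitive \<alpha> t) = ?u' t"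
      unfolding u[OF t] by (simp add: algebra_simps diff_divide_distrib)
    finally show ?thesis
      by (rule has_vector_derivative_transform_within_open[of _ _ _ "{0<..}"]) (use t u in auto)
  qed
  have vd: "vector_derivative u (at t) = ?u' t" if "t > 0" for t
    using u'[OF that] by (rule vector_derivative_at)
  have du: "u differentiable (at t)" if "t > 0" for t
    using u'[OF that] by (rule differentiableI_vector)
  have dP: "(\<lambda>s. complex_of_real (Theta_line s)) differentiable (at t)" if t: "t > 0" for t
  proof -
    obtain D where "(Theta_line has_real_derivative D) (at t)" using Theta_line_differentiable[OF t] .
    hence "((\<lambda>s. complex_of_real (Theta_line s)) has_vector_derivative of_real D) (at t)"
      by (rule has_vector_derivative_of_real)
    thus ?thesis by (rule differentiableI_vector)
  qed
  have local: "f differentiable (at t)" if t: "t > 0" and g: "g differentiable (at t)" and fg: "\<And>s. s > 0 \<Longrightarrow> f s = g s" for f g :: "real \<Rightarrow> complex" and t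
  proof -
    have "(g has_vector_derivative vector_derivative g (at t)) (at t)" using g by (simp add: vector_derivative_works)
    hence "(f has_vector_derivative vector_derivative g (at t)) (at t)"
      by (rule has_vector_derivative_transform_within_open[of _ _ _ "{0<..}"]) (use t fg in auto)
    thus ?thesis by (rule differentiableI_vector)
  qed
  have ddu: "(\<lambda>s. vector_derivative u (at s)) differentiable (at t)" if t: "t > 0" for t
  proof (rule local[OF t _ vd])
    show "?u' differentiable (at t)"
      by (intro differentiable_divide differentiable_diff differentiable_mult dP du t of_real_differentiable differentiable_const) (use t in simp)
  qed
  have Du: "D_times u t = c / \<i> * of_real (Theta_line t) - of_real \<alpha> * u t" if "t > 0" for t
    unfolding D_times_def vd[OF that] using that by (simp add: field_simps)
  have dDu: "D_times u differentiable (at t)" if t: "t > 0" for t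
  proof (rule local[OF t _ Du])
    show "(\<lambda>t. c / \<i> * of_real (Theta_line t) - of_real \<alpha> * u t) differentiable (at t)"
      by (intro differentiable_diff differentiable_mult dP du t differentiable_const)
  qed
  have ode: "L_op phi00 (D_times u) t + of_real \<alpha> * L_op phi00 u t = 0" if t: "t > 0" for t
  proof -
    let ?v = "\<lambda>s. D_times u s + of_real \<alpha> * u s"
    have dv: "?v differentiable (at t)"
      by (intro differentiable_add differentiable_mult dDu du t differentiable_const)
    have "((\<lambda>s. ?v s / of_real (Theta_line s)) has_vector_derivative
            \<i> * L_op phi00 ?v t / of_real (t * Theta_line t)) (at t)"
      using dv by (intro L_op_quotient_deriv[OF t]) (simp only: vector_derivative_works)
    hence "((\<lambda>s. c / \<i>) has_vector_derivative
            \<i> * L_op phi00 ?v t / of_real (t * Theta_line t)) (at t)"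
    proof (rule has_vector_derivative_transform_within_open[of _ _ _ "{0<..}"])
      fix s :: real assume "s \<in> {0<..}"
      thus "?v s / of_real (Theta_line s) = c / \<i>" using Du[of s] Theta_line_pos[of s] by simp
    qed (use t in auto)
    from vector_derivative_unique_at[OF this has_vector_derivative_const]
    have "L_op phi00 ?v t = 0" using t Theta_line_pos[of t] by simp
    thus ?thesis using L_op_linear[OF dDu[OF t] du[OF t]] by simp
  qed
  have norm_u: "norm (u t) = norm (c * primitive \<alpha> t)" if "t > 0" for t
    using u[OF that] by (simp add: norm_mult)
  have "((\<lambda>t. norm (c * primitive \<alpha> t)) \<longlongrightarrow> norm (c * 0)) (at_right 0)"
    by (intro tendsto_intros primitive_tendsto)
  moreover have "\<forall>\<^sub>F t in at_right 0. norm (c * primitive \<alpha> t) = norm (u t)"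
    using eventually_at_right_less[of 0] by (auto elim!: eventually_mono simp: norm_u)
  ultimately have "((\<lambda>t. norm (u t)) \<longlongrightarrow> 0) (at_right 0)" by (simp add: tendsto_cong)
  hence u_0: "(u \<longlongrightarrow> 0) (at_right 0)" by (rule tendsto_norm_zero_cancel)
  have "((\<lambda>t. norm (c * primitive \<alpha> t)) \<longlongrightarrow> norm (c * kernel_transform (\<i> * of_real \<alpha>))) at_top"
    by (intro tendsto_intros primitive_tendsto)
  moreover have "\<forall>\<^sub>F t in at_top. norm (c * primitive \<alpha> t) = norm (u t)"
    by (rule eventually_mono[OF eventually_gt_at_top[of 0]]) (simp add: norm_u)
  ultimately have "((\<lambda>t. norm (u t)) \<longlongrightarrow> 0) at_top" unfolding c by (simp add: tendsto_cong)
  hence u_inf: "(u \<longlongrightarrow> 0) at_top" by (rule tendsto_norm_zero_cancel)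
  show ?thesis unfolding bvp_solution_def using du ddu ode u_0 u_inf by blast
qed

theorem theorem3p3p1:
  fixes \<alpha> :: real
  shows "(riemann_Xi (of_real \<alpha>) \<noteq> 0 \<longrightarrow>
            (\<forall>u. bvp_solution \<alpha> u \<longleftrightarrow> (\<forall>t>0. u t = 0))) \<and>
         (riemann_Xi (of_real \<alpha>) = 0 \<longrightarrow>
            (\<forall>u. bvp_solution \<alpha> u \<longleftrightarrow> (\<exists>C. \<forall>t>0. u t = C * u_sol \<alpha> t)))"
proof -
  have iff: "bvp_solution \<alpha> u \<longleftrightarrow> (\<exists>c. c * riemann_Xi (of_real \<alpha>) = 0 \<and> (\<forall>t>0. u t = c * u_sol \<alpha> t))" for u
    unfolding riemann_Xi_eq_kernel_transform
    using bvp_solution_imp[of \<alpha> u] bvp_solution_if[of _ \<alpha> u] by (auto simp: u_sol_eq)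
  show ?thesis unfolding iff by auto
qed

end
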